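(* Let $f:\mathbb{R}^d\to\mathbb{R}$ be bounded from below by $f^*:=\min_{x\in\mathbb{R}^d}f(x)$ and differentiable with $L$-Lipschitz gradient, i.e. $\|\nabla f(x)-\nabla f(y)\|\le L\|x-y\|$ for all $x,y\in\mathbb{R}^d$. Suppose the stochastic gradients are unbiased and their noise is uniformly bounded by $\sigma_g\ge 0$ (as made precise in the context), let $q>\sigma_g$ with $q>0$, let $\beta\in[0,1)$, and let the step sizes $\{\alpha_t\}_{t\ge1}$ be positive and nonincreasing with $\alpha_t=\Theta(t^{-(1-\theta)})$ for some $\theta\in(0,1/2)$. Let $\{x_t\}$ be the SHB-CN (stochastic heavy-ball) iterates $$x_{t+1}=x_t-\alpha_t g_t^{CN}+\beta(x_t-x_{t-1}),\quad t\ge1,$$ and set $v_t:=x_t-x_{t-1}$ and $z_t:=x_t+\frac{\beta}{1-\beta}v_t$. Then, with $\Psi_q(r):=\min\{r^2,qr\}$, almost surely $$\sum_{t=1}^{\infty}\alpha_t\Psi_q(\|\nabla f(x_t)\|)<\infty,\qquad \sum_{t=1}^{\infty}\|v_t\|^2<\infty.$$ In particular, $\|v_t\|\to0$ and $\|z_t-x_t\|\to0$ a.s. Moreover, $$\min_{1\le i\le t}\Psi_q(\|\nabla f(x_i)\|)=o(t^{-\theta})\quad\text{a.s.},$$ and thus $$\min_{1\le i\le t}\|\nabla f(x_i)\|=o(t^{-\theta/2})\quad\text{a.s.}$$ If, in addition, $f$ is $\mu$-strongly convex for some $\mu>0$, i.e. $f(y)\ge f(x)+\langle\nabla f(x),y-x\rangle+\frac{\mu}{2}\|y-x\|^2$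 for all $x,y\in\mathbb{R}^d$, then $$\min_{1\le i\le t}\big(f(x_i)-f^*\big)=o(t^{-\theta})\quad\text{a.s.}$$
   Context: $\|\cdot\|$ is the Euclidean norm on $\mathbb{R}^d$. Stochastic gradient oracle: $\nabla f(x;\xi)$ denotes a (measurable) stochastic gradient at $x$ with random sample $\xi$; at step $t$ a random sample $\xi_t$ is drawn. Clipping: for $q>0$ and $v\in\mathbb{R}^d$, $\mathrm{clip}_q(v):=\min(1,q/\|v\|)\,v$ (with $\mathrm{clip}_q(0)=0$). Clipped noisy stochastic gradient: $g_t^{CN}:=\mathrm{clip}_q(\nabla f(x_t;\xi_t))+q\zeta_t$, where $\zeta_t\sim\mathcal{N}(0,\sigma_{CN}^2 I)$ is zero-mean Gaussian noise in $\mathbb{R}^d$ with variance parameter $\sigma_{CN}^2$, independent of the past and of $\xi_t$. Filtration: $\mathcal{F}_t$ is the natural filtration, i.e. the $\sigma$-algebra generated by the initialization and $\xi_1,\dots,\xi_{t-1},\zeta_1,\dots,\zeta_{t-1}$; the initial points $x_0,x_1$ are $\mathcal{F}_1$-measurable, so $x_t$ is $\mathcal{F}_t$-measurable. Unbiasedness: $\mathbb{E}[\nabla f(x_t;\xi_t)\mid\mathcal{F}_t]=\nabla f(x_t)$ for all $t$. Uniformly bounded noise: $\|\nabla f(x;\xi)-\nabla f(x)\|\le\sigma_g$ almost surely for every $x\in\mathbb{R}^d$; in particular $\|\nabla f(x_t;\xi_t)-\nabla f(x_t)\|\le\sigma_g$ a.s. for every $t$. Asymptotic notation $\Theta(\cdot)$,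 $o(\cdot)$ is as $t\to\infty$; "$o(\cdot)$ a.s." means that the $o(\cdot)$ relation holds along almost every sample path. Step sizes are deterministic. *)

theory Defs
  imports "HOL-Probability.Probability" "HOL-Library.Landau_Symbols"
begin

definition clip :: "real \<Rightarrow> 'a::real_normed_vector \<Rightarrow> 'a" where
  "clip q v = min 1 (q / norm v) *\<^sub>R v"

definition Psi :: "real \<Rightarrow> real \<Rightarrow> real" where
  "Psi q r = min (r\<^sup>2) (q * r)"

text \<open>The law of \<open>\<sigma>\<close> times a standard Gaussian vector, i.e. the centred normal distribution
  with covariance \<open>\<sigma>\<^sup>2\<close> times the identity; the scaling form covers \<open>\<sigma> = 0\<close> as a point mass.\<close>

definition isotropic_gaussian :: "real \<Rightarrow> 'a::euclidean_space measure" where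
  "isotropic_gaussian \<sigma> =
     distr (density lborel (\<lambda>x. ennreal (\<Prod>b\<in>Basis. normal_density 0 1 (x \<bullet> b)))) borel
           (\<lambda>x. \<sigma> *\<^sub>R x)"

text \<open>The library has conditional expectations for real functions only; for vectors it is taken
  coordinatewise. Since \<^const>\<open>real_cond_exp\<close> is built from the conditional expectations of the
  positive and negative parts, it is meaningful whenever those are almost surely finite, without
  global integrability.\<close>

definition vec_cond_exp ::
  "'o measure \<Rightarrow> 'o measure \<Rightarrow> ('o \<Rightarrow> 'a::euclidean_space) \<Rightarrow> 'o \<Rightarrow> 'a" where
  "vec_cond_exp M F Y \<omega> = (\<Sum>b\<in>Basis. real_cond_exp M F (\<lambda>\<omega>. Y \<omega> \<bullet> b) \<omega> *\<^sub>R b)"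

definition rv_events :: "'o measure \<Rightarrow> 'b measure \<Rightarrow> ('o \<Rightarrow> 'b) \<Rightarrow> 'o set set" where
  "rv_events M N X = {X -` A \<inter> space M | A. A \<in> sets N}"

text \<open>Natural filtration: \<open>x0\<close>, \<open>x1\<close> are the initial points, \<open>\<xi>\<close> the samples (with values in
  the measurable space \<open>S\<close>) and \<open>\<zeta>\<close> the injected noise.\<close>

definition natural_filtration ::
  "'o measure \<Rightarrow> 's measure \<Rightarrow> ('o \<Rightarrow> 'a::euclidean_space) \<Rightarrow> ('o \<Rightarrow> 'a)
     \<Rightarrow> (nat \<Rightarrow> 'o \<Rightarrow> 's) \<Rightarrow> (nat \<Rightarrow> 'o \<Rightarrow> 'a) \<Rightarrow> nat \<Rightarrow> 'o measure" where
  "natural_filtration M S x0 x1 \<xi> \<zeta> t =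
     sigma (space M)
       (rv_events M borel x0 \<union> rv_events M borel x1 \<union>
        (\<Union>i\<in>{1..<t}. rv_events M S (\<xi> i) \<union> rv_events M borel (\<zeta> i)))"

end

theory Submission
  imports Defs
begin

text \<open>The auxiliary points satisfy \<open>z (t + 1) = z t - \<alpha> t / (1 - \<beta>) * g t\<close>. Clipping moves a
  stochastic gradient by at most \<open>max 0 (norm m + \<sigma> - q)\<close>, where \<open>m\<close> is the true gradient, so that
  \<open>m \<bullet> clip q Y - m \<bullet> (Y - m)\<close> is pathwise at least \<open>(q - \<sigma>) / q * Psi q (norm m)\<close> even for
  \<open>\<sigma>\<close> close to \<open>q\<close>. Since the clipped noisy gradients have bounded second moments, and
  the velocity is a contraction driven by them, the descent inequality along \<open>z\<close> telescopes in
  expectation up to a summable error. As all summands are nonnegative, finiteness of the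
  expected sums gives almost sure summability, without any martingale convergence theorem.
  The rates follow by comparing the running minimum with the sums over \<open>t / 2 < i \<le> t\<close>.\<close>

text \<open>Three obstacles shape the argument. Unbiasedness concerns the raw stochastic gradient
  \<open>Y\<close>, while clipping is nonlinear. The comparison is therefore made pathwise with
  \<open>m \<bullet> (Y - m)\<close>, which is linear in the noise and integrates to zero.
  \<open>Psi\<close> records the two regimes: \<open>r\<^sup>2\<close> while the gradient survives
  clipping, \<open>q * r\<close> beyond. Next, momentum cancels along \<open>z\<close>, but the
  gradient is sampled at \<open>x\<close>; the mismatch is of the order of the velocity times the
  step and is absorbed by the summable expectations of squared velocities and the square-summable
  steps. Finally, without moments of the initial points the expectation of \<open>f\<close> along
  \<open>z\<close> may be infinite, so the summability argument is carried out over a general finite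
  measure and applied to an equivalent weighted one. The bound \<theta> < 1/2 makes the squared
  steps summable, and \<theta> itself is the growth exponent of \<open>t * \<alpha> t\<close>, which
  becomes the rate.\<close>

section \<open>Clipping and the function \<open>Psi\<close>\<close>

lemma norm_clip_le: "q > 0 \<Longrightarrow> norm (clip q v) \<le> q"
  by (cases "v = 0") (auto simp: clip_def min_def field_simps)

text \<open>\<open>clip q\<close> is the radial projection onto the closed ball of radius
  \<open>q\<close>, so the displacement is exactly the overshoot.\<close>

lemma norm_diff_clip:
  assumes "q > 0"
  shows "norm (v - clip q v) = max 0 (norm v - q)"
proof (cases "norm v \<le> q")
  case True
  then have "clip q v = v"
    using assms by (cases "v = 0") (auto simp: clip_def min_def field_simps)
  then show ?thesis using True by simp
next
  case False
  then have "v \<noteq> 0" using assms by auto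
  have le1: "q / norm v \<le> 1" using False \<open>v \<noteq> 0\<close> by (simp add: divide_le_eq)
  then have "clip q v = (q / norm v) *\<^sub>R v" by (simp add: clip_def)
  then have "v - clip q v = (1 - q / norm v) *\<^sub>R v"
    by (simp add: scaleR_diff_left)
  then have "norm (v - clip q v) = (1 - q / norm v) * norm v" using le1 by simp
  also have "\<dots> = norm v - q" using \<open>v \<noteq> 0\<close> by (simp add: field_simps)
  finally show ?thesis using False by simp
qed

lemma Psi_nonneg: "q > 0 \<Longrightarrow> r \<ge> 0 \<Longrightarrow> Psi q r \<ge> 0"
  by (simp add: Psi_def)

lemma Psi_mono: "q > 0 \<Longrightarrow> 0 \<le> r \<Longrightarrow> r \<le> s \<Longrightarrow> Psi q r \<le> Psi q s"
  unfolding Psi_def by (intro min.mono power_mono mult_left_mono) auto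

text \<open>The two branches cross at \<open>r = q\<close> with common value
  \<open>q\<^sup>2\<close>, and the linear branch is active only above it.\<close>

lemma Psi_eq_square:
  assumes "q > 0" "r \<ge> 0" "Psi q r < q\<^sup>2"
  shows "Psi q r = r\<^sup>2"
proof (rule ccontr)
  assume "Psi q r \<noteq> r\<^sup>2"
  then have 1: "Psi q r = q * r" "q * r < r\<^sup>2" by (auto simp: Psi_def min_def split: if_splits)
  then have "q < r" using assms(2) by (cases "r = 0") (auto simp: power2_eq_square)
  then have "q * q < q * r" using assms(1) by simp
  then show False using 1 assms(3) by (simp add: power2_eq_square)
qed

text \<open>By Cauchy-Schwarz the clipping error costs at most
  \<open>r * max 0 (r - (q - s))\<close> out of \<open>r\<^sup>2\<close>, leaving
  \<open>r\<^sup>2\<close> if \<open>r \<le> q - s\<close> and \<open>(q - s) * r\<close> otherwise.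
  The factor \<open>(q - s) / q\<close> turns the branch \<open>q * r\<close> into
  \<open>(q - s) * r\<close>; being at most 1, it is harmless on the quadratic branch.\<close>

lemma inner_clip_ge:
  fixes m Y :: "'a::real_inner"
  assumes "0 \<le> s" "s < q" "norm (Y - m) \<le> s"
  shows "inner m (clip q Y) \<ge> inner m (Y - m) + (q - s) / q * Psi q (norm m)"
proof -
  define r where "r = norm m"
  have r0: "r \<ge> 0" by (simp add: r_def)
  have q0: "q > 0" using assms by simp
  have "norm Y \<le> r + s"
    unfolding r_def using assms(3) norm_triangle_sub[of Y m] by linarith
  then have "norm (Y - clip q Y) \<le> max 0 (r - (q - s))"
    using norm_diff_clip[OF q0, of Y] by auto
  then have "inner m (Y - clip q Y) \<le> r * max 0 (r - (q - s))"
    using norm_cauchy_schwarz[of m "Y - clip q Y"] r0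
    by (smt (verit) mult_left_mono r_def)
  then have "inner m (clip q Y) \<ge> inner m (Y - m) + (r\<^sup>2 - r * max 0 (r - (q - s)))"
    by (simp add: inner_diff_right r_def power2_norm_eq_inner)
  moreover have "(q - s) / q * Psi q r \<le> r\<^sup>2 - r * max 0 (r - (q - s))"
  proof (cases "r \<le> q - s")
    case True
    have "(q - s) / q * Psi q r \<le> 1 * Psi q r"
      using assms q0 Psi_nonneg[OF q0 r0] by (intro mult_right_mono) auto
    then show ?thesis using True by (auto simp: Psi_def)
  next
    case False
    have "(q - s) / q * Psi q r \<le> (q - s) / q * (q * r)"
      using assms q0 by (intro mult_left_mono) (auto simp: Psi_def)
    also have "\<dots> = (q - s) * r" using q0 by simp
    also have "\<dots> = r\<^sup>2 - r * max 0 (r - (q - s))"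
      using False by (simp add: power2_eq_square algebra_simps)
    finally show ?thesis .
  qed
  ultimately show ?thesis by (simp add: r_def)
qed

section \<open>Smooth and strongly convex functions\<close>

text \<open>The mean value theorem on the segment from \<open>x\<close> to \<open>y\<close>, with
  the intermediate parameter bounded by 1, yields the constant \<open>L\<close>; integrating along
  the segment would give \<open>L / 2\<close>. The difference only changes constants of summable
  errors.\<close>

lemma lipschitz_gradient_upper_bound:
  fixes f :: "'a::real_inner \<Rightarrow> real"
  assumes "\<And>y. GDERIV f y :> grad y" and "L-lipschitz_on UNIV grad"
  shows "f y \<le> f x + inner (grad x) (y - x) + L * (norm (y - x))\<^sup>2"
proof -
  define \<gamma> where "\<gamma> t = x + t *\<^sub>R (y - x)" for t :: real
  have der: "((\<lambda>t. f (\<gamma> t)) has_real_derivative inner (grad (\<gamma> t)) (y - x)) (at t)" for t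
  proof -
    have "(f has_derivative (\<lambda>h. inner h (grad (\<gamma> t)))) (at (\<gamma> t))"
      using assms(1)[of "\<gamma> t"] by (simp add: gderiv_def inner_commute)
    moreover have "(\<gamma> has_derivative (\<lambda>h. h *\<^sub>R (y - x))) (at t)"
      unfolding \<gamma>_def by (auto intro!: derivative_eq_intros)
    ultimately have "((\<lambda>t. f (\<gamma> t)) has_derivative
        (\<lambda>h. inner (h *\<^sub>R (y - x)) (grad (\<gamma> t)))) (at t)"
      by (rule has_derivative_compose[rotated])
    then show ?thesis
      by (simp add: has_field_derivative_def inner_commute mult.commute[of _ "inner _ _"])
  qed
  obtain t where t: "0 < t" "t < 1" "f (\<gamma> 1) - f (\<gamma> 0) = (1 - 0) * inner (grad (\<gamma> t)) (y - x)"
    using MVT2[of 0 1 "\<lambda>t. f (\<gamma> t)" "\<lambda>t. inner (grad (\<gamma> t)) (y - x)"] der by auto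
  have L: "L \<ge> 0" using assms(2) by (rule lipschitz_on_nonneg)
  have "norm (grad (\<gamma> t) - grad x) \<le> L * norm (\<gamma> t - x)"
    using lipschitz_onD[OF assms(2), of "\<gamma> t" x] by (simp add: dist_norm)
  also have "norm (\<gamma> t - x) = t * norm (y - x)" using t by (simp add: \<gamma>_def)
  also have "L * (t * norm (y - x)) \<le> L * (1 * norm (y - x))"
    using t L by (intro mult_left_mono mult_right_mono) auto
  finally have "inner (grad (\<gamma> t) - grad x) (y - x) \<le> L * norm (y - x) * norm (y - x)"
    by (smt (verit) norm_cauchy_schwarz mult_right_mono norm_ge_zero mult_1)
  then show ?thesis
    using t by (simp add: \<gamma>_def inner_diff_left power2_eq_square mult.assoc)
qed

text \<open>The Polyak-Lojasiewicz inequality: completing the square shows that the strongly convex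
  minorant, as a function of \<open>w\<close>, is lowest where
  \<open>\<mu> *\<^sub>R (w - y) = - g y\<close>.\<close>

lemma strongly_convex_gap_le:
  fixes f :: "'a::real_inner \<Rightarrow> real"
  assumes "\<mu> > 0" and "f w \<ge> f y + inner (g y) (w - y) + \<mu> / 2 * (norm (w - y))\<^sup>2"
  shows "f y - f w \<le> (norm (g y))\<^sup>2 / (2 * \<mu>)"
proof -
  have "0 \<le> (norm (g y + \<mu> *\<^sub>R (w - y)))\<^sup>2" by simp
  also have "\<dots> = (norm (g y))\<^sup>2 + 2 * \<mu> * inner (g y) (w - y) + \<mu>\<^sup>2 * (norm (w - y))\<^sup>2"
    unfolding power2_norm_eq_inner
    by (simp add: inner_add_left inner_add_right inner_commute power2_eq_square algebra_simps)
  finally have "0 \<le> (norm (g y))\<^sup>2 + 2 * \<mu> * (inner (g y) (w - y) + \<mu> / 2 * (norm (w - y))\<^sup>2)"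
    by (simp add: algebra_simps power2_eq_square)
  also have "\<dots> \<le> (norm (g y))\<^sup>2 + 2 * \<mu> * (f w - f y)"
    using assms by (intro add_left_mono mult_left_mono) auto
  finally show ?thesis using assms(1) by (simp add: field_simps)
qed

section \<open>Summability of sequences and their expectations\<close>

text \<open>A deterministic counterpart of the Robbins-Siegmund argument, to be fed with
  expectations: everything \<open>D\<close> loses is bounded by its initial value, the total
  perturbation and the floor \<open>K\<close>.\<close>

lemma summable_of_telescoping_bound:
  fixes D p r :: "nat \<Rightarrow> real"
  assumes step: "\<And>n. D (Suc n) \<le> D n - p n + r n" and lower: "\<And>n. K \<le> D n"
    and "\<And>n. 0 \<le> p n" "\<And>n. 0 \<le> r n" "summable r"
  shows "summable p"
proof (rule bounded_imp_summable)
  show "0 \<le> p n" for n by fact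
  fix n
  have "D (Suc n) + (\<Sum>k\<le>n. p k) \<le> D 0 + (\<Sum>k\<le>n. r k)"
  proof (induction n)
    case 0 then show ?case using step[of 0] by simp
  next
    case (Suc n) then show ?case using step[of "Suc n"] by simp
  qed
  moreover have "(\<Sum>k\<le>n. r k) \<le> suminf r" by (intro sum_le_suminf assms) auto
  moreover have "K \<le> D (Suc n)" by fact
  ultimately show "(\<Sum>k\<le>n. p k) \<le> D 0 + suminf r - K" by linarith
qed

text \<open>The contraction is read as a decrease of \<open>u\<close> by
  \<open>(1 - \<beta>) * u\<close>, up to the perturbation \<open>b\<close>.\<close>

lemma summable_of_contraction:
  fixes u b :: "nat \<Rightarrow> real"
  assumes "\<And>n. u (Suc n) \<le> \<beta> * u n + b n" "\<beta> < 1"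
    and "\<And>n. 0 \<le> u n" "\<And>n. 0 \<le> b n" "summable b"
  shows "summable u"
proof -
  have "summable (\<lambda>n. (1 - \<beta>) * u n)"
  proof (rule summable_of_telescoping_bound[where D = u and r = b and K = 0])
    show "u (Suc n) \<le> u n - (1 - \<beta>) * u n + b n" for n
      using assms(1)[of n] by (simp add: algebra_simps)
  qed (use assms in auto)
  then show ?thesis using assms(2) summable_mult_D[of "1 - \<beta>" u] by simp
qed

text \<open>By Tonelli the sum has finite integral, hence is finite almost everywhere.\<close>

lemma AE_summable_of_summable_integral:
  fixes u :: "nat \<Rightarrow> 'o \<Rightarrow> real"
  assumes int: "\<And>n. integrable M (u n)" and nn: "\<And>n \<omega>. 0 \<le> u n \<omega>"
    and sm: "summable (\<lambda>n. \<integral>\<omega>. u n \<omega> \<partial>M)"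
  shows "AE \<omega> in M. summable (\<lambda>n. u n \<omega>)"
proof -
  have [measurable]: "u n \<in> borel_measurable M" for n using int by auto
  have "(\<integral>\<^sup>+ \<omega>. (\<Sum>n. ennreal (u n \<omega>)) \<partial>M) = (\<Sum>n. \<integral>\<^sup>+ \<omega>. ennreal (u n \<omega>) \<partial>M)"
    by (intro nn_integral_suminf) auto
  also have "\<dots> = (\<Sum>n. ennreal (\<integral>\<omega>. u n \<omega> \<partial>M))"
    using int nn by (simp add: nn_integral_eq_integral)
  also have "\<dots> = ennreal (\<Sum>n. \<integral>\<omega>. u n \<omega> \<partial>M)"
    by (intro suminf_ennreal2 sm) (simp add: nn)
  finally have "AE \<omega> in M. (\<Sum>n. ennreal (u n \<omega>)) \<noteq> \<infinity>"
    by (intro nn_integral_PInf_AE) auto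
  then show ?thesis
    by eventually_elim (intro summable_suminf_not_top, auto simp: nn)
qed

section \<open>Rates for running minima\<close>

lemma block_sum_tendsto_0:
  fixes u :: "nat \<Rightarrow> real"
  assumes "summable u"
  shows "(\<lambda>t. \<Sum>i\<in>{t div 2..<t}. u i) \<longlonglongrightarrow> 0"
proof -
  have S: "(\<lambda>t. \<Sum>i<t. u i) \<longlonglongrightarrow> suminf u" by (rule summable_LIMSEQ[OF assms])
  have "filterlim (\<lambda>t::nat. t div 2) at_top at_top"
    unfolding filterlim_at_top_ge[where c = 0]
  proof (intro allI impI)
    fix Z :: nat
    show "\<forall>\<^sub>F t in at_top. Z \<le> t div 2"
      using eventually_ge_at_top[of "2 * Z"] by eventually_elim auto
  qed
  then have S2: "(\<lambda>t. \<Sum>i<t div 2. u i) \<longlonglongrightarrow> suminf u"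
    by (rule filterlim_compose[OF S])
  have "(\<lambda>t. (\<Sum>i<t. u i) - (\<Sum>i<t div 2. u i)) \<longlonglongrightarrow> 0"
    using tendsto_diff[OF S S2] by simp
  moreover have "(\<Sum>i<t. u i) - (\<Sum>i<t div 2. u i) = (\<Sum>i\<in>{t div 2..<t}. u i)" for t
    using sum.atLeastLessThan_concat[of 0 "t div 2" t u] by (simp add: lessThan_atLeast0)
  ultimately show ?thesis by simp
qed

text \<open>Each of the at least \<open>t / 2\<close> terms with index above \<open>t div 2\<close>
  dominates \<open>\<alpha> t * m t\<close>, since the steps decrease and \<open>m\<close> is the
  running minimum. Thus \<open>t * \<alpha> t * m t\<close> is bounded by twice a block sum that
  vanishes in the limit; the full partial sum would give only a big-O rate.\<close>

lemma running_min_smallo: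
  fixes \<alpha> h :: "nat \<Rightarrow> real"
  assumes pos: "\<And>t. t \<ge> 1 \<Longrightarrow> \<alpha> t > 0" and mono: "antimono_on {1..} \<alpha>"
    and Omega: "\<alpha> \<in> \<Omega>(\<lambda>t. real t powr (-(1 - \<theta>)))"
    and nn: "\<And>t. 0 \<le> h t" and sm: "summable (\<lambda>t. \<alpha> (Suc t) * h (Suc t))"
  shows "(\<lambda>t. MIN i\<in>{1..t}. h i) \<in> o(\<lambda>t. real t powr (-\<theta>))"
proof -
  define m where "m t = (MIN i\<in>{1..t}. h i)" for t
  define B where "B t = (\<Sum>i\<in>{t div 2..<t}. \<alpha> (Suc i) * h (Suc i))" for t
  have m_le: "m t \<le> h i" if "1 \<le> i" "i \<le> t" for i t
    unfolding m_def using that by (intro Min_le) auto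
  have m_nn: "0 \<le> m t" if "1 \<le> t" for t
    unfolding m_def using that nn by (subst Min_ge_iff) auto
  have block: "real t / 2 * \<alpha> t * m t \<le> B t" if t: "1 \<le> t" for t
  proof -
    have "real t / 2 * (\<alpha> t * m t) \<le> real (t - t div 2) * (\<alpha> t * m t)"
      using pos[OF t] m_nn[OF t] by (intro mult_right_mono) auto
    also have "\<dots> = (\<Sum>i\<in>{t div 2..<t}. \<alpha> t * m t)" by simp
    also have "\<dots> \<le> B t" unfolding B_def
    proof (intro sum_mono mult_mono)
      fix i assume i: "i \<in> {t div 2..<t}"
      show "\<alpha> t \<le> \<alpha> (Suc i)" using i by (intro monotone_onD[OF mono]) auto
      show "m t \<le> h (Suc i)" using i by (intro m_le) auto
      show "0 \<le> \<alpha> (Suc i)" using pos[of "Suc i"] by simp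
      show "0 \<le> m t" using m_nn[OF t] .
    qed
    finally show ?thesis by (simp add: mult.assoc)
  qed
  have B0: "B \<longlonglongrightarrow> 0" unfolding B_def by (rule block_sum_tendsto_0[OF sm])
  obtain c where c: "c > 0"
    and ev: "\<forall>\<^sub>F t in at_top. norm (\<alpha> t) \<ge> c * norm (real t powr (-(1 - \<theta>)))"
    using landau_omega.bigE[OF Omega] by blast
  have bound: "\<forall>\<^sub>F t in at_top. norm (m t) \<le> (2 / c) * norm (B t * real t powr (-\<theta>))"
    using ev eventually_ge_at_top[of 1]
  proof eventually_elim
    case (elim t)
    then have t: "real t > 0" by simp
    have "c * real t powr (-(1 - \<theta>)) \<le> \<alpha> t" using elim(1) pos[OF elim(2)] by simp
    then have "real t / 2 * (c * real t powr (-(1 - \<theta>))) * m t \<le> real t / 2 * \<alpha> t * m t"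
      using m_nn[of t] elim(2) by (intro mult_right_mono mult_left_mono) auto
    also have "\<dots> \<le> B t" using block[OF elim(2)] .
    \<comment> \<open>The factor \<open>t\<close> times the step order
      \<open>t powr (-(1 - \<theta>))\<close> is \<open>t powr \<theta>\<close>, the source of the
      rate.\<close>
    also have "real t / 2 * (c * real t powr (-(1 - \<theta>))) = c / 2 * real t powr \<theta>"
      using t by (simp add: powr_diff powr_minus field_simps)
    finally have *: "c / 2 * real t powr \<theta> * m t \<le> B t" .
    then have "m t \<le> 2 / c * (B t * real t powr (-\<theta>))"
      using t c by (simp add: powr_minus field_simps)
    also have "\<dots> \<le> 2 / c * norm (B t * real t powr (-\<theta>))"
      using c by (intro mult_left_mono) auto
    finally show ?case using m_nn[OF elim(2)] by simp
  qed
  have "(\<lambda>t. B t * real t powr (-\<theta>)) \<in> o(\<lambda>t. real t powr (-\<theta>))"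
  proof -
    have "B \<in> o(\<lambda>_. 1)" by (intro smalloI_tendsto) (use B0 in auto)
    then have "(\<lambda>t. B t * real t powr (-\<theta>)) \<in> o(\<lambda>t. 1 * real t powr (-\<theta>))"
      by (intro landau_o.small_big_mult) auto
    then show ?thesis by simp
  qed
  moreover have "m \<in> O(\<lambda>t. B t * real t powr (-\<theta>))"
    by (rule landau_o.bigI[OF _ bound]) (use c in auto)
  ultimately show ?thesis
    unfolding m_def[abs_def, symmetric] by (rule landau_o.big_small_trans[rotated])
qed

lemma smallo_of_square:
  fixes f g :: "'b \<Rightarrow> real"
  assumes "(\<lambda>x. (f x)\<^sup>2) \<in> o[F](\<lambda>x. (g x)\<^sup>2)"
  shows "f \<in> o[F](g)"
proof (rule landau_o.smallI)
  fix c :: real assume "c > 0"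
  then have "\<forall>\<^sub>F x in F. norm ((f x)\<^sup>2) \<le> c\<^sup>2 * norm ((g x)\<^sup>2)"
    by (intro landau_o.smallD[OF assms]) simp
  then show "\<forall>\<^sub>F x in F. norm (f x) \<le> c * norm (g x)"
  proof eventually_elim
    case (elim x)
    then have "\<bar>f x\<bar>\<^sup>2 \<le> (c * \<bar>g x\<bar>)\<^sup>2" by (simp add: power_mult_distrib)
    then show ?case using power2_le_imp_le[of "\<bar>f x\<bar>" "c * \<bar>g x\<bar>"] \<open>c > 0\<close> by simp
  qed
qed

text \<open>Since \<open>Psi q\<close> is increasing, the smallest norm is controlled by the
  smallest \<open>Psi\<close> value. That value tends to 0, so it is eventually below
  \<open>q\<^sup>2\<close>, where \<open>Psi\<close> is the square. The squared form is kept as a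
  conclusion because the strongly convex case needs it.\<close>

lemma running_min_norm_smallo:
  fixes r :: "nat \<Rightarrow> real"
  assumes q: "q > 0" and nn: "\<And>i. 0 \<le> r i" and \<theta>: "0 < \<theta>"
    and sm: "(\<lambda>t. MIN i\<in>{1..t}. Psi q (r i)) \<in> o(\<lambda>t. real t powr (-\<theta>))"
  shows "(\<lambda>t. (MIN i\<in>{1..t}. r i)\<^sup>2) \<in> o(\<lambda>t. real t powr (-\<theta>))"
    and "(\<lambda>t. MIN i\<in>{1..t}. r i) \<in> o(\<lambda>t. real t powr (-\<theta>/2))"
proof -
  define m where "m t = (MIN i\<in>{1..t}. r i)" for t
  define P where "P t = (MIN i\<in>{1..t}. Psi q (r i))" for t
  have m_nn: "0 \<le> m t" if "1 \<le> t" for t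
    unfolding m_def using that nn by (subst Min_ge_iff) auto
  have Psi_m: "Psi q (m t) \<le> P t" if t: "1 \<le> t" for t
  proof -
    have "P t \<in> (\<lambda>i. Psi q (r i)) ` {1..t}" unfolding P_def using t by (intro Min_in) auto
    then obtain i where i: "i \<in> {1..t}" "P t = Psi q (r i)" by auto
    have "m t \<le> r i" unfolding m_def using i by (intro Min_le) auto
    then show ?thesis using Psi_mono[OF q m_nn[OF t]] i by simp
  qed
  have "((\<lambda>t. real t powr (-\<theta>)) \<longlongrightarrow> 0) at_top"
    using \<theta> by (intro tendsto_neg_powr filterlim_real_sequentially) auto
  then have "(\<lambda>t. real t powr (-\<theta>)) \<in> o(\<lambda>_. 1)" by (intro smalloI_tendsto) auto
  then have "P \<in> o(\<lambda>_. 1 :: real)"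
    using sm unfolding P_def[symmetric, abs_def] by (rule landau_o.small_trans[rotated])
  then have "P \<longlonglongrightarrow> 0" using smalloD_tendsto[of P _ "\<lambda>_. 1"] by simp
  then have "\<forall>\<^sub>F t in at_top. P t < q\<^sup>2" using q by (intro order_tendstoD) auto
  then have "\<forall>\<^sub>F t in at_top. norm ((m t)\<^sup>2) \<le> 1 * norm (P t)"
    using eventually_ge_at_top[of 1]
  proof eventually_elim
    case (elim t)
    then show ?case
      using Psi_m[of t] Psi_eq_square[OF q m_nn[of t]] by auto
  qed
  then have "(\<lambda>t. (m t)\<^sup>2) \<in> O(P)" by (intro landau_o.bigI[of 1]) auto
  then show *: "(\<lambda>t. (MIN i\<in>{1..t}. r i)\<^sup>2) \<in> o(\<lambda>t. real t powr (-\<theta>))"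
    using sm unfolding P_def[symmetric, abs_def] m_def[symmetric, abs_def]
    by (rule landau_o.big_small_trans)
  have "(\<lambda>t. (m t)\<^sup>2) \<in> o(\<lambda>t. (real t powr (-\<theta>/2))\<^sup>2)"
    using * unfolding m_def[symmetric, abs_def]
    by (simp add: power2_eq_square flip: powr_add)
  then show "(\<lambda>t. MIN i\<in>{1..t}. r i) \<in> o(\<lambda>t. real t powr (-\<theta>/2))"
    unfolding m_def[symmetric, abs_def] by (rule smallo_of_square)
qed

section \<open>Square integrable random vectors\<close>

text \<open>Membership in L2 for vector-valued maps, over any measure, because it is used both under
  the probability and under its reweighting.\<close>

definition square_integrable :: "'o measure \<Rightarrow> ('o \<Rightarrow> 'a::euclidean_space) \<Rightarrow> bool" where
  "square_integrable M X \<longleftrightarrow> X \<in> borel_measurable M \<and> integrable M (\<lambda>\<omega>. (norm (X \<omega>))\<^sup>2)"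

lemma square_integrable_measurable [measurable_dest]:
  "square_integrable M X \<Longrightarrow> X \<in> borel_measurable M"
  by (simp add: square_integrable_def)

lemma square_integrable_norm_sq:
  "square_integrable M X \<Longrightarrow> integrable M (\<lambda>\<omega>. (norm (X \<omega>))\<^sup>2)"
  by (simp add: square_integrable_def)

lemma norm_add_sq_le:
  fixes a b :: "'a::real_normed_vector"
  shows "(norm (a + b))\<^sup>2 \<le> 2 * (norm a)\<^sup>2 + 2 * (norm b)\<^sup>2"
proof -
  have "(norm (a + b))\<^sup>2 \<le> (norm a + norm b)\<^sup>2"
    by (intro power_mono norm_triangle_ineq) simp
  also have "\<dots> \<le> 2 * (norm a)\<^sup>2 + 2 * (norm b)\<^sup>2"
    using sum_squares_bound[of "norm a" "norm b"] by (simp add: power2_sum)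
  finally show ?thesis .
qed

lemma square_integrable_scaleR:
  assumes "square_integrable M X"
  shows "square_integrable M (\<lambda>\<omega>. c *\<^sub>R X \<omega>)"
  using assms by (auto simp: square_integrable_def power_mult_distrib)

lemma square_integrable_add:
  assumes "square_integrable M X" "square_integrable M Y"
  shows "square_integrable M (\<lambda>\<omega>. X \<omega> + Y \<omega>)"
proof -
  note [measurable] = assms[THEN square_integrable_measurable]
  have "integrable M (\<lambda>\<omega>. 2 * (norm (X \<omega>))\<^sup>2 + 2 * (norm (Y \<omega>))\<^sup>2)"
    using assms by (auto simp: square_integrable_def)
  then have "integrable M (\<lambda>\<omega>. (norm (X \<omega> + Y \<omega>))\<^sup>2)"
    by (rule Bochner_Integration.integrable_bound) (use norm_add_sq_le in auto)
  then show ?thesis by (simp add: square_integrable_def)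
qed

lemma square_integrable_diff:
  assumes "square_integrable M X" "square_integrable M Y"
  shows "square_integrable M (\<lambda>\<omega>. X \<omega> - Y \<omega>)"
  using square_integrable_add[OF assms(1) square_integrable_scaleR[OF assms(2), of "-1"]] by simp

lemma square_integrable_inner:
  assumes "square_integrable M X" "square_integrable M Y"
  shows "integrable M (\<lambda>\<omega>. X \<omega> \<bullet> Y \<omega>)"
proof -
  note [measurable] = assms[THEN square_integrable_measurable]
  have "integrable M (\<lambda>\<omega>. (norm (X \<omega>))\<^sup>2 + (norm (Y \<omega>))\<^sup>2)"
    using assms by (auto simp: square_integrable_def)
  then show ?thesis
  proof (rule Bochner_Integration.integrable_bound)
    show "AE \<omega> in M. norm (X \<omega> \<bullet> Y \<omega>) \<le> norm ((norm (X \<omega>))\<^sup>2 + (norm (Y \<omega>))\<^sup>2)"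
    proof (rule AE_I2)
      fix \<omega>
      have "\<bar>X \<omega> \<bullet> Y \<omega>\<bar> \<le> norm (X \<omega>) * norm (Y \<omega>)" by (rule Cauchy_Schwarz_ineq2)
      also have "\<dots> \<le> 2 * norm (X \<omega>) * norm (Y \<omega>)"
        using mult_nonneg_nonneg[OF norm_ge_zero[of "X \<omega>"] norm_ge_zero[of "Y \<omega>"]] by linarith
      also have "\<dots> \<le> (norm (X \<omega>))\<^sup>2 + (norm (Y \<omega>))\<^sup>2" by (rule sum_squares_bound)
      finally show "norm (X \<omega> \<bullet> Y \<omega>) \<le> norm ((norm (X \<omega>))\<^sup>2 + (norm (Y \<omega>))\<^sup>2)" by simp
    qed
  qed simp
qed

lemma (in finite_measure) square_integrable_const: "square_integrable M (\<lambda>_. c)"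
  by (simp add: square_integrable_def)

lemma (in finite_measure) square_integrable_bounded:
  assumes "X \<in> borel_measurable M" "AE \<omega> in M. norm (X \<omega>) \<le> C"
  shows "square_integrable M X"
proof -
  have "AE \<omega> in M. norm ((norm (X \<omega>))\<^sup>2) \<le> C\<^sup>2"
    using assms(2) by eventually_elim (simp add: power_mono)
  then show ?thesis
    using assms(1) unfolding square_integrable_def by (auto intro!: integrable_const_bound)
qed

text \<open>Lipschitz maps grow at most linearly; the constant part is integrable because the
  measure is finite.\<close>

lemma (in finite_measure) square_integrable_lipschitz:
  fixes h :: "'e::euclidean_space \<Rightarrow> 'd::euclidean_space"
  assumes X: "square_integrable M X" and h: "L-lipschitz_on UNIV h"
  shows "square_integrable M (\<lambda>\<omega>. h (X \<omega>))"
proof -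
  note [measurable] = X[THEN square_integrable_measurable]
  have [measurable]: "h \<in> borel_measurable borel"
    using h by (intro borel_measurable_continuous_onI lipschitz_on_continuous_on)
  have "integrable M (\<lambda>\<omega>. 2 * (norm (h 0))\<^sup>2 + 2 * (L\<^sup>2 * (norm (X \<omega>))\<^sup>2))"
    using X by (auto simp: square_integrable_def)
  then have "integrable M (\<lambda>\<omega>. (norm (h (X \<omega>)))\<^sup>2)"
  proof (rule Bochner_Integration.integrable_bound)
    have "(norm (h y))\<^sup>2 \<le> 2 * (norm (h 0))\<^sup>2 + 2 * (L\<^sup>2 * (norm y)\<^sup>2)" for y
    proof -
      have "(norm (h 0 + (h y - h 0)))\<^sup>2 \<le> 2 * (norm (h 0))\<^sup>2 + 2 * (norm (h y - h 0))\<^sup>2"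
        by (rule norm_add_sq_le)
      moreover have "(norm (h y - h 0))\<^sup>2 \<le> (L * norm y)\<^sup>2"
        using lipschitz_onD[OF h, of y 0] by (intro power_mono) (auto simp: dist_norm)
      ultimately show ?thesis by (simp add: power_mult_distrib)
    qed
    then show "AE \<omega> in M. norm ((norm (h (X \<omega>)))\<^sup>2) \<le>
        norm (2 * (norm (h 0))\<^sup>2 + 2 * (L\<^sup>2 * (norm (X \<omega>))\<^sup>2))" by simp
  qed simp
  then show ?thesis by (simp add: square_integrable_def)
qed

text \<open>\<open>f\<close> lies between the constant \<open>fstar\<close> and the quadratic
  majorant at the origin, both integrable along \<open>X\<close>.\<close>

lemma (in finite_measure) integrable_smooth_square_integrable:
  fixes f :: "'e::euclidean_space \<Rightarrow> real"
  assumes X: "square_integrable M X"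
    and lower: "\<And>y. fstar \<le> f y"
    and f_grad: "\<And>y. GDERIV f y :> grad y" and lip: "L-lipschitz_on UNIV grad"
  shows "integrable M (\<lambda>\<omega>. f (X \<omega>))"
proof -
  note [measurable] = X[THEN square_integrable_measurable]
  have [measurable]: "f \<in> borel_measurable borel"
    using f_grad unfolding gderiv_def
    by (intro borel_measurable_continuous_onI has_derivative_continuous_on[where f' = "\<lambda>x h. h \<bullet> grad x"])
       (auto simp: has_derivative_at_withinI)
  have "integrable M (\<lambda>\<omega>. \<bar>fstar\<bar> + \<bar>f 0\<bar> + \<bar>grad 0 \<bullet> X \<omega>\<bar> + L * (norm (X \<omega>))\<^sup>2)"
    using square_integrable_norm_sq[OF X]
      square_integrable_inner[OF square_integrable_const[of "grad 0"] X] by auto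
  then show ?thesis
  proof (rule Bochner_Integration.integrable_bound)
    have "\<bar>f y\<bar> \<le> \<bar>fstar\<bar> + \<bar>f 0\<bar> + \<bar>grad 0 \<bullet> y\<bar> + L * (norm y)\<^sup>2" for y
      using lower[of y] lipschitz_gradient_upper_bound[OF f_grad lip, of y 0]
        mult_nonneg_nonneg[OF lipschitz_on_nonneg[OF lip] zero_le_power2[of "norm y"]]
      unfolding diff_zero by linarith
    then show "AE \<omega> in M. norm (f (X \<omega>)) \<le>
        norm (\<bar>fstar\<bar> + \<bar>f 0\<bar> + \<bar>grad 0 \<bullet> X \<omega>\<bar> + L * (norm (X \<omega>))\<^sup>2)"
      by (intro AE_I2) (smt (verit) real_norm_def)
  qed simp
qed

section \<open>Heavy-ball recursion\<close>

text \<open>Convexity of the square with weights \<beta> and \<open>1 - \<beta>\<close>, the second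
  point being the forcing divided by \<open>1 - \<beta>\<close>. This keeps the factor of
  \<open>(norm v)\<^sup>2\<close> at \<beta> < 1, whereas the crude bound with factors 2 would give
  \<open>2 * \<beta>\<^sup>2\<close>, which can exceed 1.\<close>

lemma heavy_ball_velocity_bound:
  fixes v g :: "'a::real_inner"
  assumes "0 \<le> \<beta>" "\<beta> < 1"
  shows "(norm (\<beta> *\<^sub>R v - a *\<^sub>R g))\<^sup>2 \<le> \<beta> * (norm v)\<^sup>2 + a\<^sup>2 / (1 - \<beta>) * (norm g)\<^sup>2"
proof -
  have conv: "(\<beta> * s + (1 - \<beta>) * t)\<^sup>2 \<le> \<beta> * s\<^sup>2 + (1 - \<beta>) * t\<^sup>2" for s t :: real
  proof -
    have "\<beta> * s\<^sup>2 + (1 - \<beta>) * t\<^sup>2 - (\<beta> * s + (1 - \<beta>) * t)\<^sup>2 = \<beta> * (1 - \<beta>) * (s - t)\<^sup>2"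
      by (simp add: power2_eq_square algebra_simps)
    moreover have "0 \<le> \<beta> * (1 - \<beta>) * (s - t)\<^sup>2" using assms by simp
    ultimately show ?thesis by linarith
  qed
  define t where "t = \<bar>a\<bar> * norm g / (1 - \<beta>)"
  have "norm (\<beta> *\<^sub>R v - a *\<^sub>R g) \<le> norm (\<beta> *\<^sub>R v) + norm (a *\<^sub>R g)"
    by (rule norm_triangle_ineq4)
  also have "\<dots> = \<beta> * norm v + (1 - \<beta>) * t" using assms by (simp add: t_def)
  finally have "(norm (\<beta> *\<^sub>R v - a *\<^sub>R g))\<^sup>2 \<le> (\<beta> * norm v + (1 - \<beta>) * t)\<^sup>2"
    by (intro power_mono) auto
  also have "\<dots> \<le> \<beta> * (norm v)\<^sup>2 + (1 - \<beta>) * t\<^sup>2" by (rule conv)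
  also have "(1 - \<beta>) * t\<^sup>2 = a\<^sup>2 / (1 - \<beta>) * (norm g)\<^sup>2"
    using assms by (simp add: t_def power2_eq_square)
  finally show ?thesis .
qed

text \<open>The step starts from \<open>z = y + c *\<^sub>R v\<close>, but the gradient in the
  conclusion is taken at \<open>y\<close>. Replacing one by the other costs
  \<open>L * c * norm v\<close> times \<open>k * norm g\<close>, which Young's inequality splits
  into squares.\<close>

lemma heavy_ball_descent:
  fixes f :: "'a::real_inner \<Rightarrow> real"
  assumes f_grad: "\<And>y. GDERIV f y :> grad y" and lip: "L-lipschitz_on UNIV grad"
    and c: "0 \<le> c" and k: "0 \<le> k"
  shows "f (y + c *\<^sub>R v - k *\<^sub>R g) \<le> f (y + c *\<^sub>R v) - k * (grad y \<bullet> g)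
           + L * (c + 1) * ((norm v)\<^sup>2 + k\<^sup>2 * (norm g)\<^sup>2)"
proof -
  define z where "z = y + c *\<^sub>R v"
  have L: "L \<ge> 0" by (rule lipschitz_on_nonneg[OF lip])
  have "f (z - k *\<^sub>R g) \<le> f z + grad z \<bullet> ((z - k *\<^sub>R g) - z) + L * (norm ((z - k *\<^sub>R g) - z))\<^sup>2"
    by (rule lipschitz_gradient_upper_bound[OF f_grad lip])
  then have 1: "f (z - k *\<^sub>R g) \<le> f z - k * (grad z \<bullet> g) + L * (k\<^sup>2 * (norm g)\<^sup>2)"
    by (simp add: power_mult_distrib)
  have "norm (grad y - grad z) \<le> L * (c * norm v)"
    using lipschitz_onD[OF lip, of y z] c by (simp add: dist_norm z_def)
  then have "(grad y - grad z) \<bullet> g \<le> L * (c * norm v) * norm g"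
    by (meson norm_cauchy_schwarz mult_right_mono norm_ge_zero order_trans)
  then have "k * ((grad y - grad z) \<bullet> g) \<le> k * (L * (c * norm v) * norm g)"
    using k by (rule mult_left_mono)
  also have "\<dots> = L * c * (norm v * (k * norm g))" by simp
  also have "\<dots> \<le> L * c * ((norm v)\<^sup>2 + (k * norm g)\<^sup>2)"
  proof (rule mult_left_mono)
    have "0 \<le> norm v * (k * norm g)" using k by simp
    then show "norm v * (k * norm g) \<le> (norm v)\<^sup>2 + (k * norm g)\<^sup>2"
      using sum_squares_bound[of "norm v" "k * norm g"] by linarith
  qed (use L c in simp)
  finally have 2: "k * (grad y \<bullet> g) - k * (grad z \<bullet> g)
      \<le> L * c * ((norm v)\<^sup>2 + k\<^sup>2 * (norm g)\<^sup>2)"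
    by (simp add: inner_diff_left right_diff_distrib power_mult_distrib)
  \<comment> \<open>The surplus \<open>L * (norm v)\<^sup>2\<close> merely brings the quadratic
    remainder and the gradient mismatch under one factor \<open>L * (c + 1)\<close>.\<close>
  have "0 \<le> L * (norm v)\<^sup>2" using L by simp
  then have "f (z - k *\<^sub>R g) \<le> f z - k * (grad y \<bullet> g)
      + L * (c + 1) * ((norm v)\<^sup>2 + k\<^sup>2 * (norm g)\<^sup>2)"
    using 1 2 by (simp add: algebra_simps)
  then show ?thesis by (simp add: z_def)
qed


lemma square_integrable_cong:
  assumes "\<And>\<omega>. \<omega> \<in> space M \<Longrightarrow> X \<omega> = Y \<omega>"
  shows "square_integrable M X \<longleftrightarrow> square_integrable M Y"
proof -
  have "X \<in> borel_measurable M \<longleftrightarrow> Y \<in> borel_measurable M"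
    using assms by (rule measurable_cong)
  moreover have "integrable M (\<lambda>\<omega>. (norm (X \<omega>))\<^sup>2) \<longleftrightarrow> integrable M (\<lambda>\<omega>. (norm (Y \<omega>))\<^sup>2)"
    by (intro Bochner_Integration.integrable_cong) (simp_all add: assms)
  ultimately show ?thesis by (simp add: square_integrable_def)
qed

text \<open>All probabilistic input is condensed into \<open>g_le\<close> and \<open>drift\<close>,
  so that the lemma applies to a measure under which the noise need not be independent.
  \<open>drift\<close> may presuppose square integrability of \<open>x t\<close>, which is
  established here by induction from the initial points.\<close>

lemma (in finite_measure) heavy_ball_summable:
  fixes f :: "'e::euclidean_space \<Rightarrow> real" and x g :: "nat \<Rightarrow> 'a \<Rightarrow> 'e" and a :: "nat \<Rightarrow> real"
  assumes lower: "\<And>y. fstar \<le> f y"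
    and f_grad: "\<And>y. GDERIV f y :> grad y" and lip: "L-lipschitz_on UNIV grad"
    and h_meas: "h \<in> borel_measurable borel"
    and h_nonneg: "\<And>y. 0 \<le> h y" and h_le: "\<And>y. h y \<le> (norm (grad y))\<^sup>2"
    and \<beta>: "0 \<le> \<beta>" "\<beta> < 1" and c: "0 < c"
    and a_nonneg: "\<And>t. 1 \<le> t \<Longrightarrow> 0 \<le> a t" and a_sq: "summable (\<lambda>n. (a (Suc n))\<^sup>2)"
    and init: "square_integrable M (x 0)" "square_integrable M (x 1)"
    and g: "\<And>t. 1 \<le> t \<Longrightarrow> square_integrable M (g t)"
    and g_le: "\<And>t. 1 \<le> t \<Longrightarrow> (\<integral>\<omega>. (norm (g t \<omega>))\<^sup>2 \<partial>M) \<le> C"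
    and drift: "\<And>t. 1 \<le> t \<Longrightarrow> square_integrable M (x t) \<Longrightarrow>
          c * (\<integral>\<omega>. h (x t \<omega>) \<partial>M) \<le> (\<integral>\<omega>. grad (x t \<omega>) \<bullet> g t \<omega> \<partial>M)"
    and step: "\<And>t \<omega>. 1 \<le> t \<Longrightarrow> \<omega> \<in> space M \<Longrightarrow>
          x (t + 1) \<omega> = x t \<omega> - a t *\<^sub>R g t \<omega> + \<beta> *\<^sub>R (x t \<omega> - x (t - 1) \<omega>)"
  shows "AE \<omega> in M. summable (\<lambda>n. a (Suc n) * h (x (Suc n) \<omega>))"
    and "AE \<omega> in M. summable (\<lambda>n. (norm (x (Suc n) \<omega> - x n \<omega>))\<^sup>2)"
proof -
  define b where "b = \<beta> / (1 - \<beta>)"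
  define k where "k n = a (Suc n) / (1 - \<beta>)" for n
  \<comment> \<open>Indices are shifted by one: \<open>V n\<close> and \<open>Z n\<close> are the
    velocity and the auxiliary point at time \<open>Suc n\<close>.\<close>
  define V where "V n \<omega> = x (Suc n) \<omega> - x n \<omega>" for n \<omega>
  define Z where "Z n \<omega> = x (Suc n) \<omega> + b *\<^sub>R V n \<omega>" for n \<omega>
  have b: "0 \<le> b" using \<beta> by (simp add: b_def)
  have k: "0 \<le> k n" for n using \<beta> a_nonneg[of "Suc n"] by (simp add: k_def)
  have L: "0 \<le> L" by (rule lipschitz_on_nonneg[OF lip])
  have C: "0 \<le> C" by (rule order_trans[OF _ g_le[of 1]]) simp_all
  have stepS: "x (Suc (Suc n)) \<omega> = x (Suc n) \<omega> - a (Suc n) *\<^sub>R g (Suc n) \<omega> + \<beta> *\<^sub>R V n \<omega>"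
    if "\<omega> \<in> space M" for n \<omega> using step[of "Suc n" \<omega>] that by (simp add: V_def)
  have V_step: "V (Suc n) \<omega> = \<beta> *\<^sub>R V n \<omega> - a (Suc n) *\<^sub>R g (Suc n) \<omega>"
    if "\<omega> \<in> space M" for n \<omega> using stepS[OF that, of n] by (simp add: V_def)
  \<comment> \<open>Because \<open>1 + b = 1 / (1 - \<beta>)\<close> and
    \<open>b = \<beta> / (1 - \<beta>)\<close>, the momentum part of \<open>V (Suc n)\<close>
    reproduces \<open>b *\<^sub>R V n\<close>, so \<open>Z\<close> moves by the gradient step
    alone.\<close>
  have Z_step: "Z (Suc n) \<omega> = x (Suc n) \<omega> + b *\<^sub>R V n \<omega> - k n *\<^sub>R g (Suc n) \<omega>"
    if "\<omega> \<in> space M" for n \<omega>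
  proof -
    have "Z (Suc n) \<omega> = x (Suc n) \<omega> + (1 + b) *\<^sub>R V (Suc n) \<omega>"
      by (simp add: Z_def V_def scaleR_add_left)
    also have "1 + b = 1 / (1 - \<beta>)" using \<beta> by (simp add: b_def field_simps)
    also have "(1 / (1 - \<beta>)) *\<^sub>R V (Suc n) \<omega> = b *\<^sub>R V n \<omega> - k n *\<^sub>R g (Suc n) \<omega>"
      by (simp add: V_step[OF that] b_def k_def scaleR_diff_right)
    finally show ?thesis by simp
  qed
  \<comment> \<open>Consecutive iterates are carried together because the recursion has order
    two.\<close>
  have x_sq: "square_integrable M (x n) \<and> square_integrable M (x (Suc n))" for n
  proof (induction n)
    case 0 then show ?case using init by simp
  next
    case (Suc n)
    then have "square_integrable M (\<lambda>\<omega>. x (Suc n) \<omega> - a (Suc n) *\<^sub>R g (Suc n) \<omega> + \<beta> *\<^sub>R V n \<omega>)"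
      unfolding V_def
      by (intro square_integrable_add square_integrable_diff square_integrable_scaleR g) auto
    then have "square_integrable M (x (Suc (Suc n)))"
      using square_integrable_cong[of M "x (Suc (Suc n))", OF stepS] by simp
    then show ?case using Suc by simp
  qed
  have V_sq: "square_integrable M (V n)" for n
    unfolding V_def using x_sq[of n] by (auto intro: square_integrable_diff)
  have Z_sq: "square_integrable M (Z n)" for n
    unfolding Z_def using x_sq[of n]
    by (intro square_integrable_add square_integrable_scaleR V_sq) auto
  have grad_sq: "square_integrable M (\<lambda>\<omega>. grad (x n \<omega>))" for n
    using x_sq[of n] lip by (auto intro: square_integrable_lipschitz)
  note g_int [simp] = square_integrable_norm_sq[OF g, of "Suc n" for n, simplified]
  note V_int [simp] = square_integrable_norm_sq[OF V_sq]
  have gg_int [simp]: "integrable M (\<lambda>\<omega>. grad (x (Suc n) \<omega>) \<bullet> g (Suc n) \<omega>)" for n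
    by (intro square_integrable_inner grad_sq g) simp
  have f_int [simp]: "integrable M (\<lambda>\<omega>. f (Z n \<omega>))" for n
    by (rule integrable_smooth_square_integrable[OF Z_sq lower f_grad lip])
  have h_int: "integrable M (\<lambda>\<omega>. h (x n \<omega>))" for n
  proof (rule Bochner_Integration.integrable_bound[OF square_integrable_norm_sq[OF grad_sq[of n]]])
    show "(\<lambda>\<omega>. h (x n \<omega>)) \<in> borel_measurable M"
      using x_sq[of n] h_meas by (auto simp: square_integrable_def)
  qed (use h_nonneg h_le in simp)

  have V_le: "(\<integral>\<omega>. (norm (V (Suc n) \<omega>))\<^sup>2 \<partial>M)
      \<le> \<beta> * (\<integral>\<omega>. (norm (V n \<omega>))\<^sup>2 \<partial>M) + C / (1 - \<beta>) * (a (Suc n))\<^sup>2" for n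
  proof -
    have "(\<integral>\<omega>. (norm (V (Suc n) \<omega>))\<^sup>2 \<partial>M)
        \<le> (\<integral>\<omega>. \<beta> * (norm (V n \<omega>))\<^sup>2 + (a (Suc n))\<^sup>2 / (1 - \<beta>) * (norm (g (Suc n) \<omega>))\<^sup>2 \<partial>M)"
    proof (intro integral_mono)
      fix \<omega> assume "\<omega> \<in> space M"
      then show "(norm (V (Suc n) \<omega>))\<^sup>2
          \<le> \<beta> * (norm (V n \<omega>))\<^sup>2 + (a (Suc n))\<^sup>2 / (1 - \<beta>) * (norm (g (Suc n) \<omega>))\<^sup>2"
        by (simp only: V_step heavy_ball_velocity_bound[OF \<beta>])
    qed auto
    also have "\<dots> = \<beta> * (\<integral>\<omega>. (norm (V n \<omega>))\<^sup>2 \<partial>M)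
        + (a (Suc n))\<^sup>2 / (1 - \<beta>) * (\<integral>\<omega>. (norm (g (Suc n) \<omega>))\<^sup>2 \<partial>M)"
      by simp
    also have "\<dots> \<le> \<beta> * (\<integral>\<omega>. (norm (V n \<omega>))\<^sup>2 \<partial>M) + (a (Suc n))\<^sup>2 / (1 - \<beta>) * C"
      using g_le[of "Suc n"] \<beta> by (intro add_left_mono mult_left_mono) auto
    finally show ?thesis by (simp add: mult.commute)
  qed
  have V_sum: "summable (\<lambda>n. \<integral>\<omega>. (norm (V n \<omega>))\<^sup>2 \<partial>M)"
    by (rule summable_of_contraction[where b = "\<lambda>n. C / (1 - \<beta>) * (a (Suc n))\<^sup>2", OF V_le \<beta>(2)])
      (use C \<beta> in \<open>auto intro!: summable_mult a_sq\<close>)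
  then show "AE \<omega> in M. summable (\<lambda>n. (norm (x (Suc n) \<omega> - x n \<omega>))\<^sup>2)"
    unfolding V_def[symmetric] by (intro AE_summable_of_summable_integral) auto

  define K where "K = L * (b + 1)"
  have K: "0 \<le> K" using L b by (simp add: K_def)
  have Z_le: "(\<integral>\<omega>. f (Z (Suc n) \<omega>) \<partial>M)
      \<le> (\<integral>\<omega>. f (Z n \<omega>) \<partial>M) - k n * (c * (\<integral>\<omega>. h (x (Suc n) \<omega>) \<partial>M))
        + K * ((\<integral>\<omega>. (norm (V n \<omega>))\<^sup>2 \<partial>M) + (k n)\<^sup>2 * C)" for n
  proof -
    have "(\<integral>\<omega>. f (Z (Suc n) \<omega>) \<partial>M)
        \<le> (\<integral>\<omega>. f (Z n \<omega>) - k n * (grad (x (Suc n) \<omega>) \<bullet> g (Suc n) \<omega>)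
              + K * ((norm (V n \<omega>))\<^sup>2 + (k n)\<^sup>2 * (norm (g (Suc n) \<omega>))\<^sup>2) \<partial>M)"
    proof (intro integral_mono)
      fix \<omega> assume "\<omega> \<in> space M"
      show "f (Z (Suc n) \<omega>) \<le> f (Z n \<omega>) - k n * (grad (x (Suc n) \<omega>) \<bullet> g (Suc n) \<omega>)
              + K * ((norm (V n \<omega>))\<^sup>2 + (k n)\<^sup>2 * (norm (g (Suc n) \<omega>))\<^sup>2)"
        unfolding Z_step[OF \<open>\<omega> \<in> space M\<close>] K_def Z_def[of n]
        by (rule heavy_ball_descent[OF f_grad lip b k])
    qed auto
    also have "\<dots> = (\<integral>\<omega>. f (Z n \<omega>) \<partial>M) - k n * (\<integral>\<omega>. grad (x (Suc n) \<omega>) \<bullet> g (Suc n) \<omega> \<partial>M)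
        + K * ((\<integral>\<omega>. (norm (V n \<omega>))\<^sup>2 \<partial>M) + (k n)\<^sup>2 * (\<integral>\<omega>. (norm (g (Suc n) \<omega>))\<^sup>2 \<partial>M))"
      by simp
    also have "\<dots> \<le> (\<integral>\<omega>. f (Z n \<omega>) \<partial>M) - k n * (c * (\<integral>\<omega>. h (x (Suc n) \<omega>) \<partial>M))
        + K * ((\<integral>\<omega>. (norm (V n \<omega>))\<^sup>2 \<partial>M) + (k n)\<^sup>2 * C)"
      using k K g_le[of "Suc n"] drift[of "Suc n"] x_sq[of n]
      by (intro add_mono diff_mono mult_left_mono) auto
    finally show ?thesis .
  qed
  have "summable (\<lambda>n. k n * (c * (\<integral>\<omega>. h (x (Suc n) \<omega>) \<partial>M)))"
  proof (rule summable_of_telescoping_bound[where D = "\<lambda>n. \<integral>\<omega>. f (Z n \<omega>) \<partial>M"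
        and r = "\<lambda>n. K * ((\<integral>\<omega>. (norm (V n \<omega>))\<^sup>2 \<partial>M) + (k n)\<^sup>2 * C)", OF Z_le])
    \<comment> \<open>The measure need not have mass 1, so its mass enters the lower bound.\<close>
    show "fstar * measure M (space M) \<le> (\<integral>\<omega>. f (Z n \<omega>) \<partial>M)" for n
      using integral_mono[of M "\<lambda>_. fstar" "\<lambda>\<omega>. f (Z n \<omega>)"] lower by (simp add: mult.commute)
    show "0 \<le> k n * (c * (\<integral>\<omega>. h (x (Suc n) \<omega>) \<partial>M))" for n
      using k c h_nonneg by (auto intro!: mult_nonneg_nonneg)
    show "0 \<le> K * ((\<integral>\<omega>. (norm (V n \<omega>))\<^sup>2 \<partial>M) + (k n)\<^sup>2 * C)" for n
      using K C by (auto intro!: mult_nonneg_nonneg add_nonneg_nonneg)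
    have "summable (\<lambda>n. (k n)\<^sup>2 * C)"
      using summable_mult[OF a_sq, of "C / (1 - \<beta>)\<^sup>2"] by (simp add: k_def power_divide mult.commute)
    then show "summable (\<lambda>n. K * ((\<integral>\<omega>. (norm (V n \<omega>))\<^sup>2 \<partial>M) + (k n)\<^sup>2 * C))"
      by (intro summable_mult summable_add V_sum)
  qed
  \<comment> \<open>This factor undoes the \<open>c\<close> of the drift and the
    \<open>1 / (1 - \<beta>)\<close> inside \<open>k n\<close>.\<close>
  then have "summable (\<lambda>n. (1 - \<beta>) / c * (k n * (c * (\<integral>\<omega>. h (x (Suc n) \<omega>) \<partial>M))))"
    by (rule summable_mult)
  also have "(\<lambda>n. (1 - \<beta>) / c * (k n * (c * (\<integral>\<omega>. h (x (Suc n) \<omega>) \<partial>M))))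
      = (\<lambda>n. \<integral>\<omega>. \<bar>a (Suc n)\<bar> * h (x (Suc n) \<omega>) \<partial>M)"
  proof
    fix n
    have "1 - \<beta> \<noteq> 0" using \<beta> by simp
    then show "(1 - \<beta>) / c * (k n * (c * (\<integral>\<omega>. h (x (Suc n) \<omega>) \<partial>M)))
        = (\<integral>\<omega>. \<bar>a (Suc n)\<bar> * h (x (Suc n) \<omega>) \<partial>M)"
      using c a_nonneg[of "Suc n"] by (simp add: k_def)
  qed
  finally have "AE \<omega> in M. summable (\<lambda>n. \<bar>a (Suc n)\<bar> * h (x (Suc n) \<omega>))"
    using h_int h_nonneg by (intro AE_summable_of_summable_integral) auto
  then show "AE \<omega> in M. summable (\<lambda>n. a (Suc n) * h (x (Suc n) \<omega>))"
    using a_nonneg by simp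
qed

section \<open>Moments of the injected Gaussian noise\<close>

lemma lborel_integral_uminus:
  fixes f :: "'a::euclidean_space \<Rightarrow> real"
  assumes "f \<in> borel_measurable borel"
  shows "(\<integral>x. f (- x) \<partial>lborel) = (\<integral>x. f x \<partial>lborel)"
proof -
  have "lborel = distr lborel borel (\<lambda>x::'a. - x)"
    using lborel_affine[of "-1" "0::'a"] by (simp add: density_1)
  then have "(\<integral>x. f x \<partial>lborel) = (\<integral>x. f x \<partial>distr lborel borel (\<lambda>x::'a. - x))" by simp
  also have "\<dots> = (\<integral>x. f (- x) \<partial>lborel)" using assms by (intro integral_distr) auto
  finally show ?thesis ..
qed

text \<open>The second moment is finite because the integral of each squared coordinate factorises
  into one-dimensional Gaussian integrals; the mean vanishes because the density is even.\<close>

lemma isotropic_gaussian_moments: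
  fixes b :: "'a::euclidean_space"
  shows "integrable (isotropic_gaussian \<sigma> :: 'a measure) (\<lambda>x. (norm x)\<^sup>2)"
    and "(\<integral>x. x \<bullet> b \<partial>(isotropic_gaussian \<sigma>)) = 0"
proof -
  define p where "p x = (\<Prod>b\<in>Basis. normal_density 0 1 (x \<bullet> b))" for x :: 'a
  have p_nn: "0 \<le> p x" for x by (auto simp: p_def intro!: prod_nonneg)
  have p_meas [measurable]: "p \<in> borel_measurable borel" unfolding p_def by measurable
  have coord: "integrable lborel (\<lambda>x. p x * (x \<bullet> c)\<^sup>2)" if c: "c \<in> Basis" for c :: 'a
  proof (rule integrableI_nonneg)
    \<comment> \<open>The second-moment integrand in coordinate \<open>c\<close> and the plain
      density in all others, so that the product over \<open>Basis\<close> is the density times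
      \<open>(x \<bullet> c)\<^sup>2\<close>.\<close>
    define \<phi> where "\<phi> b y = normal_density 0 1 y * (if b = c then y\<^sup>2 else 1)" for b :: 'a and y
    have \<phi>_nn: "0 \<le> \<phi> b y" for b y by (simp add: \<phi>_def)
    have \<phi>_int: "integrable lborel (\<phi> b)" for b
      using integrable_std_normal_moment[of 2] integrable_std_normal_moment[of 0]
      by (cases "b = c") (simp_all add: \<phi>_def[abs_def])
    have "(\<Prod>b\<in>Basis. \<phi> b (x \<bullet> b)) = p x * (x \<bullet> c)\<^sup>2" for x :: 'a
      using c by (simp add: \<phi>_def p_def prod.distrib prod.delta)
    then have "(\<integral>\<^sup>+ x. ennreal (p x * (x \<bullet> c)\<^sup>2) \<partial>lborel)
        = (\<integral>\<^sup>+ x. (\<Prod>b\<in>Basis. ennreal (\<phi> b (x \<bullet> b))) \<partial>lborel)"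
      using \<phi>_nn by (simp add: prod_ennreal)
    also have "\<dots> = (\<Prod>b\<in>Basis. \<integral>\<^sup>+ y. ennreal (\<phi> b y) \<partial>lborel)"
      using borel_measurable_integrable[OF \<phi>_int] by (intro nn_integral_lborel_prod) auto
    also have "\<dots> = (\<Prod>b\<in>Basis. ennreal (\<integral>y. \<phi> b y \<partial>lborel))"
      using \<phi>_int \<phi>_nn by (simp add: nn_integral_eq_integral)
    also have "\<dots> < \<infinity>"
      using \<phi>_nn by (subst prod_ennreal) auto
    finally show "(\<integral>\<^sup>+ x. ennreal (p x * (x \<bullet> c)\<^sup>2) \<partial>lborel) < \<infinity>" .
  qed (use p_nn in auto)
  have "integrable lborel (\<lambda>x. \<Sum>c\<in>Basis. p x * (x \<bullet> c)\<^sup>2)"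
    using coord by auto
  moreover have "(norm x)\<^sup>2 = (\<Sum>c\<in>Basis. (x \<bullet> c)\<^sup>2)" for x :: 'a
    by (subst power2_norm_eq_inner, subst euclidean_inner) (simp add: power2_eq_square)
  ultimately have sq: "integrable lborel (\<lambda>x. p x * (norm x)\<^sup>2)"
    by (simp add: sum_distrib_left)
  have eq: "isotropic_gaussian \<sigma> = distr (density lborel p) borel (\<lambda>x. \<sigma> *\<^sub>R x)"
    by (simp add: isotropic_gaussian_def p_def)
  show "integrable (isotropic_gaussian \<sigma> :: 'a measure) (\<lambda>x. (norm x)\<^sup>2)"
    unfolding eq using integrable_mult_right[OF sq, of "\<sigma>\<^sup>2"] p_nn
    by (subst integrable_distr_eq; (subst integrable_density)?)
       (auto simp: power_mult_distrib mult_ac)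
  have "p (- x) = p x" for x by (simp add: p_def normal_density_def)
  then have "(\<integral>x. p x * (x \<bullet> b) \<partial>lborel) = - (\<integral>x. p x * (x \<bullet> b) \<partial>lborel)"
    using lborel_integral_uminus[of "\<lambda>x. p x * (x \<bullet> b)"] by simp
  then have "(\<integral>x. p x * (x \<bullet> b) \<partial>lborel) = 0" by simp
  then show "(\<integral>x. x \<bullet> b \<partial>(isotropic_gaussian \<sigma>)) = 0"
    unfolding eq using p_nn
    by (subst integral_distr; (subst integral_density)?)
       (auto simp: mult.left_commute[of _ \<sigma>])
qed

section \<open>Conditional expectation and independence\<close>

text \<open>An indicator commutes with taking positive and negative parts, so it can be pulled out
  of both nonnegative conditional expectations, with no integrability of \<open>Y\<close>.\<close>

lemma (in sigma_finite_subalgebra) real_cond_exp_indicator: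
  assumes B: "B \<in> sets F" and Y [measurable]: "Y \<in> borel_measurable M"
  shows "AE \<omega> in M. real_cond_exp M F (\<lambda>\<omega>. indicator B \<omega> * Y \<omega>) \<omega>
           = indicator B \<omega> * real_cond_exp M F Y \<omega>"
proof -
  have ind: "(indicator B :: _ \<Rightarrow> ennreal) \<in> borel_measurable F" using B by simp
  have "(\<lambda>\<omega>. indicator B \<omega> * ennreal (Y \<omega>)) = (\<lambda>\<omega>. ennreal (indicator B \<omega> * Y \<omega>))"
    "(\<lambda>\<omega>. indicator B \<omega> * ennreal (- Y \<omega>)) = (\<lambda>\<omega>. ennreal (- (indicator B \<omega> * Y \<omega>)))"
    by (auto simp: indicator_def)
  then have "AE \<omega> in M. indicator B \<omega> * nn_cond_exp M F (\<lambda>\<omega>. ennreal (Y \<omega>)) \<omega>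
        = nn_cond_exp M F (\<lambda>\<omega>. ennreal (indicator B \<omega> * Y \<omega>)) \<omega>"
    "AE \<omega> in M. indicator B \<omega> * nn_cond_exp M F (\<lambda>\<omega>. ennreal (- Y \<omega>)) \<omega>
        = nn_cond_exp M F (\<lambda>\<omega>. ennreal (- (indicator B \<omega> * Y \<omega>))) \<omega>"
    using nn_cond_exp_prod[OF ind, of "\<lambda>\<omega>. ennreal (Y \<omega>)"]
      nn_cond_exp_prod[OF ind, of "\<lambda>\<omega>. ennreal (- Y \<omega>)"] by simp_all
  then show ?thesis
  proof eventually_elim
    case (elim \<omega>)
    then show ?case
      by (cases "\<omega> \<in> B") (simp_all add: real_cond_exp_def flip: elim)
  qed
qed

lemma (in finite_measure_subalgebra) real_cond_exp_diff_eq_0: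
  assumes m [measurable]: "m \<in> borel_measurable F" and Y [measurable]: "Y \<in> borel_measurable M"
    and ce: "AE \<omega> in M. real_cond_exp M F Y \<omega> = m \<omega>"
    and bd: "AE \<omega> in M. \<bar>Y \<omega> - m \<omega>\<bar> \<le> s"
  shows "AE \<omega> in M. real_cond_exp M F (\<lambda>\<omega>. Y \<omega> - m \<omega>) \<omega> = 0"
proof -
  have [measurable]: "m \<in> borel_measurable M" by (rule measurable_from_subalg[OF subalg m])
  text \<open>Neither \<open>Y\<close> nor \<open>m\<close> need be integrable, hence the localisation to bounded \<open>m\<close>.\<close>
  define B where "B n = {\<omega> \<in> space F. \<bar>m \<omega>\<bar> \<le> real n}" for n
  have B: "B n \<in> sets F" for n unfolding B_def by measurable
  then have [measurable]: "B n \<in> sets M" for n using subalg by (auto simp: subalgebra_def)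
  have "AE \<omega> in M. indicator (B n) \<omega> * real_cond_exp M F (\<lambda>\<omega>. Y \<omega> - m \<omega>) \<omega> = 0" for n
  proof -
    have "\<bar>indicator (B n) \<omega> * m \<omega>\<bar> \<le> real n" for \<omega>
      by (auto simp: B_def indicator_def)
    then have im: "integrable M (\<lambda>\<omega>. indicator (B n) \<omega> * m \<omega>)"
      by (intro integrable_const_bound[of _ "real n"]) auto
    \<comment> \<open>On \<open>B n\<close> the triangle inequality gives this bound; off
      \<open>B n\<close> it needs \<open>s \<ge> 0\<close>, which the noise bound itself
      implies.\<close>
    have "AE \<omega> in M. norm (indicator (B n) \<omega> * Y \<omega>) \<le> real n + s"
      using bd by eventually_elim (auto simp: B_def indicator_def)
    then have iY: "integrable M (\<lambda>\<omega>. indicator (B n) \<omega> * Y \<omega>)"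
      by (intro integrable_const_bound) auto
    have imF: "(\<lambda>\<omega>. indicator (B n) \<omega> * m \<omega>) \<in> borel_measurable F"
      using B[of n] by measurable
    have eq: "(\<lambda>\<omega>. indicator (B n) \<omega> * (Y \<omega> - m \<omega>))
        = (\<lambda>\<omega>. indicator (B n) \<omega> * Y \<omega> - indicator (B n) \<omega> * m \<omega>)"
      by (simp add: right_diff_distrib)
    show ?thesis
      using real_cond_exp_indicator[OF B[of n] Y] real_cond_exp_diff[OF iY im]
        real_cond_exp_F_meas[OF im imF] ce
        real_cond_exp_indicator[OF B[of n], of "\<lambda>\<omega>. Y \<omega> - m \<omega>", simplified eq]
      by (auto elim!: AE_mp)
  qed
  then have "AE \<omega> in M. \<forall>n. indicator (B n) \<omega> * real_cond_exp M F (\<lambda>\<omega>. Y \<omega> - m \<omega>) \<omega> = 0"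
    unfolding AE_all_countable by blast
  then show ?thesis
  proof (rule AE_mp, intro AE_I2 impI)
    fix \<omega> assume \<omega>: "\<omega> \<in> space M"
      and z: "\<forall>n. indicator (B n) \<omega> * real_cond_exp M F (\<lambda>\<omega>. Y \<omega> - m \<omega>) \<omega> = 0"
    obtain n where "\<bar>m \<omega>\<bar> \<le> real n" using real_arch_simple by blast
    then have "\<omega> \<in> B n" using \<omega> subalg by (simp add: B_def subalgebra_def)
    then show "real_cond_exp M F (\<lambda>\<omega>. Y \<omega> - m \<omega>) \<omega> = 0" using z[rule_format, of n] by simp
  qed
qed

lemma vec_cond_exp_inner_Basis:
  "b \<in> Basis \<Longrightarrow> vec_cond_exp M F Y \<omega> \<bullet> b = real_cond_exp M F (\<lambda>\<omega>. Y \<omega> \<bullet> b) \<omega>"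
  by (simp add: vec_cond_exp_def)

text \<open>Orthogonality of a martingale difference to the past: the bounded \<open>Y - m\<close>
  lies in L2, so its pairing with \<phi> is integrable and the conditional expectation, which is 0,
  can be inserted in each coordinate.\<close>

lemma (in finite_measure_subalgebra) integral_inner_vec_cond_exp_diff:
  fixes m Y \<phi> :: "'a \<Rightarrow> 'e::euclidean_space"
  assumes m [measurable]: "m \<in> borel_measurable F" and Y [measurable]: "Y \<in> borel_measurable M"
    and ce: "AE \<omega> in M. vec_cond_exp M F Y \<omega> = m \<omega>"
    and bd: "AE \<omega> in M. norm (Y \<omega> - m \<omega>) \<le> s"
    and \<phi>: "\<phi> \<in> borel_measurable F" and \<phi>_sq: "square_integrable M \<phi>"
  shows "integrable M (\<lambda>\<omega>. \<phi> \<omega> \<bullet> (Y \<omega> - m \<omega>))"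
    and "(\<integral>\<omega>. \<phi> \<omega> \<bullet> (Y \<omega> - m \<omega>) \<partial>M) = 0"
proof -
  have [measurable]: "m \<in> borel_measurable M" by (rule measurable_from_subalg[OF subalg m])
  have W: "square_integrable M (\<lambda>\<omega>. Y \<omega> - m \<omega>)"
    by (rule square_integrable_bounded[OF _ bd]) measurable
  then show "integrable M (\<lambda>\<omega>. \<phi> \<omega> \<bullet> (Y \<omega> - m \<omega>))"
    by (rule square_integrable_inner[OF \<phi>_sq])
  have coord: "integrable M (\<lambda>\<omega>. (\<phi> \<omega> \<bullet> b) * ((Y \<omega> - m \<omega>) \<bullet> b)) \<and>
      (\<integral>\<omega>. (\<phi> \<omega> \<bullet> b) * ((Y \<omega> - m \<omega>) \<bullet> b) \<partial>M) = 0" if b: "b \<in> Basis" for b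
  proof -
    have "AE \<omega> in M. real_cond_exp M F (\<lambda>\<omega>. Y \<omega> \<bullet> b - m \<omega> \<bullet> b) \<omega> = 0"
    proof (rule real_cond_exp_diff_eq_0)
      show "AE \<omega> in M. real_cond_exp M F (\<lambda>\<omega>. Y \<omega> \<bullet> b) \<omega> = m \<omega> \<bullet> b"
        using ce by eventually_elim (metis vec_cond_exp_inner_Basis[OF b])
      show "AE \<omega> in M. \<bar>Y \<omega> \<bullet> b - m \<omega> \<bullet> b\<bar> \<le> s"
        using bd by eventually_elim (use Basis_le_norm[OF b] in \<open>auto simp flip: inner_diff_left intro: order_trans\<close>)
    qed measurable
    then have z: "AE \<omega> in M. real_cond_exp M F (\<lambda>\<omega>. (Y \<omega> - m \<omega>) \<bullet> b) \<omega> = 0"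
      by (simp add: inner_diff_left)
    have "integrable M (\<lambda>\<omega>. ((\<phi> \<omega> \<bullet> b) *\<^sub>R b) \<bullet> (Y \<omega> - m \<omega>))"
    proof (rule square_integrable_inner[OF _ W])
      have "square_integrable M (\<lambda>\<omega>. (\<phi> \<omega> \<bullet> b) *\<^sub>R b) \<longleftrightarrow> integrable M (\<lambda>\<omega>. (\<phi> \<omega> \<bullet> b)\<^sup>2)"
        using \<phi>_sq b by (auto simp: square_integrable_def)
      moreover have sq_le: "(y \<bullet> b)\<^sup>2 \<le> (norm y)\<^sup>2" for y :: 'e
        using Basis_le_norm[OF b, of y] abs_le_square_iff[of "y \<bullet> b" "norm y"] by simp
      have "integrable M (\<lambda>\<omega>. (\<phi> \<omega> \<bullet> b)\<^sup>2)"
        by (rule Bochner_Integration.integrable_bound[OF square_integrable_norm_sq[OF \<phi>_sq]])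
          (use \<phi>_sq sq_le in \<open>auto simp: square_integrable_def\<close>)
      ultimately show "square_integrable M (\<lambda>\<omega>. (\<phi> \<omega> \<bullet> b) *\<^sub>R b)" by simp
    qed
    then have int: "integrable M (\<lambda>\<omega>. (\<phi> \<omega> \<bullet> b) * ((Y \<omega> - m \<omega>) \<bullet> b))"
      by (simp add: inner_commute)
    have \<phi>b: "(\<lambda>\<omega>. \<phi> \<omega> \<bullet> b) \<in> borel_measurable F" using \<phi> by measurable
    have "(\<integral>\<omega>. (\<phi> \<omega> \<bullet> b) * ((Y \<omega> - m \<omega>) \<bullet> b) \<partial>M)
        = (\<integral>\<omega>. (\<phi> \<omega> \<bullet> b) * real_cond_exp M F (\<lambda>\<omega>. (Y \<omega> - m \<omega>) \<bullet> b) \<omega> \<partial>M)"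
      by (rule real_cond_exp_intg(2)[symmetric, OF int \<phi>b]) measurable
    also have "\<dots> = (\<integral>\<omega>. 0 \<partial>M)"
    proof (rule integral_cong_AE)
      show "(\<lambda>\<omega>. \<phi> \<omega> \<bullet> b * real_cond_exp M F (\<lambda>\<omega>. (Y \<omega> - m \<omega>) \<bullet> b) \<omega>) \<in> borel_measurable M"
        using measurable_from_subalg[OF subalg \<phi>] by measurable
    qed (use z in auto)
    finally show ?thesis using int by simp
  qed
  have "(\<integral>\<omega>. \<phi> \<omega> \<bullet> (Y \<omega> - m \<omega>) \<partial>M)
      = (\<integral>\<omega>. (\<Sum>b\<in>Basis. (\<phi> \<omega> \<bullet> b) * ((Y \<omega> - m \<omega>) \<bullet> b)) \<partial>M)"
    by (subst euclidean_inner) simp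
  also have "\<dots> = 0" using coord by simp
  finally show "(\<integral>\<omega>. \<phi> \<omega> \<bullet> (Y \<omega> - m \<omega>) \<partial>M) = 0" .
qed

text \<open>Preimages of a sigma-algebra already form one; this links \<open>rv_events\<close> to
  independence of random variables, which is phrased with generated sigma-algebras.\<close>

lemma sigma_sets_rv_events:
  assumes "X \<in> space M \<rightarrow> space N"
  shows "sigma_sets (space M) (rv_events M N X) = rv_events M N X"
proof -
  have "rv_events M N X = sets (vimage_algebra (space M) X N)"
    using sets_vimage_algebra2[OF assms] by (simp add: rv_events_def)
  then show ?thesis
    using sets.sigma_sets_eq[of "vimage_algebra (space M) X N"] by simp
qed

text \<open>Coordinates inherit independence because they generate smaller sigma-algebras; each
  product then integrates to a product of means, one of which is 0.\<close>

lemma (in prob_space) integral_inner_indep: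
  fixes \<phi> \<zeta> :: "'a \<Rightarrow> 'e::euclidean_space"
  assumes indep: "indep_set (sets F) (rv_events M borel \<zeta>)"
    and F: "subalgebra M F" and \<phi>: "\<phi> \<in> borel_measurable F"
    and \<phi>_sq: "square_integrable M \<phi>" and \<zeta>_sq: "square_integrable M \<zeta>"
    and mean: "\<And>b. b \<in> Basis \<Longrightarrow> (\<integral>\<omega>. \<zeta> \<omega> \<bullet> b \<partial>M) = 0"
  shows "(\<integral>\<omega>. \<phi> \<omega> \<bullet> \<zeta> \<omega> \<partial>M) = 0"
proof -
  have \<phi>M [measurable]: "\<phi> \<in> borel_measurable M" and \<zeta>M [measurable]: "\<zeta> \<in> borel_measurable M"
    using \<phi>_sq \<zeta>_sq by (auto simp: square_integrable_def)
  have coord: "integrable M (\<lambda>\<omega>. (\<phi> \<omega> \<bullet> b) * (\<zeta> \<omega> \<bullet> b)) \<and>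
      (\<integral>\<omega>. (\<phi> \<omega> \<bullet> b) * (\<zeta> \<omega> \<bullet> b) \<partial>M) = 0" if b: "b \<in> Basis" for b
  proof -
    have "(\<lambda>\<omega>. \<phi> \<omega> \<bullet> b) \<in> borel_measurable F" using \<phi> by measurable
    then have "{(\<lambda>\<omega>. \<phi> \<omega> \<bullet> b) -` A \<inter> space M |A. A \<in> sets borel} \<subseteq> sets F"
      using F by (auto simp: subalgebra_def dest: measurable_sets)
    then have 1: "sigma_sets (space M) {(\<lambda>\<omega>. \<phi> \<omega> \<bullet> b) -` A \<inter> space M |A. A \<in> sets borel} \<subseteq> sets F"
      using sets.sigma_sets_subset[of _ F] F by (simp add: subalgebra_def)
    have "{(\<lambda>\<omega>. \<zeta> \<omega> \<bullet> b) -` A \<inter> space M |A. A \<in> sets borel} \<subseteq> rv_events M borel \<zeta>"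
    proof safe
      fix A :: "real set" assume "A \<in> sets borel"
      then have "(\<lambda>y::'e. y \<bullet> b) -` A \<inter> space borel \<in> sets borel" by measurable
      moreover have "(\<lambda>\<omega>. \<zeta> \<omega> \<bullet> b) -` A \<inter> space M
          = \<zeta> -` ((\<lambda>y. y \<bullet> b) -` A \<inter> space borel) \<inter> space M" by auto
      ultimately show "(\<lambda>\<omega>. \<zeta> \<omega> \<bullet> b) -` A \<inter> space M \<in> rv_events M borel \<zeta>"
        unfolding rv_events_def by blast
    qed
    then have 2: "sigma_sets (space M) {(\<lambda>\<omega>. \<zeta> \<omega> \<bullet> b) -` A \<inter> space M |A. A \<in> sets borel}
        \<subseteq> rv_events M borel \<zeta>"
      using sigma_sets_mono'[of _ "rv_events M borel \<zeta>" "space M"] sigma_sets_rv_events[of \<zeta> M borel]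
      by auto
    have "indep_var borel (\<lambda>\<omega>. \<phi> \<omega> \<bullet> b) borel (\<lambda>\<omega>. \<zeta> \<omega> \<bullet> b)"
      unfolding indep_var_eq
    proof (intro conjI)
      show "indep_set (sigma_sets (space M) {(\<lambda>\<omega>. \<phi> \<omega> \<bullet> b) -` A \<inter> space M |A. A \<in> sets borel})
        (sigma_sets (space M) {(\<lambda>\<omega>. \<zeta> \<omega> \<bullet> b) -` A \<inter> space M |A. A \<in> sets borel})"
        using indep unfolding indep_set_def
        by (rule indep_sets_mono_sets) (use 1 2 in \<open>auto split: bool.split\<close>)
    qed measurable
    moreover have "integrable M (\<lambda>\<omega>. \<phi> \<omega> \<bullet> b)" "integrable M (\<lambda>\<omega>. \<zeta> \<omega> \<bullet> b)"
      by (intro square_integrable_inner \<phi>_sq \<zeta>_sq square_integrable_const)+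
    ultimately show ?thesis
      using indep_var_lebesgue_integral indep_var_integrable mean[OF b] by auto
  qed
  have "(\<integral>\<omega>. \<phi> \<omega> \<bullet> \<zeta> \<omega> \<partial>M) = (\<integral>\<omega>. (\<Sum>b\<in>Basis. (\<phi> \<omega> \<bullet> b) * (\<zeta> \<omega> \<bullet> b)) \<partial>M)"
    by (subst euclidean_inner) simp
  also have "\<dots> = 0" using coord by simp
  finally show ?thesis .
qed

text \<open>Carries the uniform second-moment bound on the gradients over to the weighted
  measure.\<close>

lemma integral_density_le:
  fixes u :: "'o \<Rightarrow> real"
  assumes [measurable]: "w \<in> borel_measurable M" and w: "\<And>\<omega>. 0 \<le> w \<omega>" "\<And>\<omega>. w \<omega> \<le> (1::real)"
    and u: "integrable M u" "\<And>\<omega>. 0 \<le> u \<omega>"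
  shows "integrable (density M (\<lambda>\<omega>. ennreal (w \<omega>))) u"
    and "(\<integral>\<omega>. u \<omega> \<partial>density M (\<lambda>\<omega>. ennreal (w \<omega>))) \<le> (\<integral>\<omega>. u \<omega> \<partial>M)"
proof -
  have [measurable]: "u \<in> borel_measurable M" using u by auto
  have le: "w \<omega> * u \<omega> \<le> u \<omega>" for \<omega> using w u by (simp add: mult_left_le_one_le)
  have int: "integrable M (\<lambda>\<omega>. w \<omega> * u \<omega>)"
    by (rule Bochner_Integration.integrable_bound[OF u(1)]) (use le w u in auto)
  then show "integrable (density M (\<lambda>\<omega>. ennreal (w \<omega>))) u"
    using w by (subst integrable_density) auto
  show "(\<integral>\<omega>. u \<omega> \<partial>density M (\<lambda>\<omega>. ennreal (w \<omega>))) \<le> (\<integral>\<omega>. u \<omega> \<partial>M)"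
    using w int u le by (subst integral_density) (auto intro!: integral_mono)
qed

section \<open>The natural filtration\<close>

lemma space_natural_filtration [simp]: "space (natural_filtration M S x0 x1 \<xi> \<zeta> t) = space M"
  by (simp add: natural_filtration_def space_measure_of_conv)

lemma sets_natural_filtration:
  "sets (natural_filtration M S x0 x1 \<xi> \<zeta> t) = sigma_sets (space M)
     (rv_events M borel x0 \<union> rv_events M borel x1 \<union>
        (\<Union>i\<in>{1..<t}. rv_events M S (\<xi> i) \<union> rv_events M borel (\<zeta> i)))"
  unfolding natural_filtration_def by (rule sets_measure_of) (auto simp: rv_events_def)

lemma rv_events_subset_sets: "X \<in> M \<rightarrow>\<^sub>M N \<Longrightarrow> rv_events M N X \<subseteq> sets M"
  by (auto simp: rv_events_def)

lemma measurable_if_rv_events_subset: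
  assumes "X \<in> M \<rightarrow>\<^sub>M N" "rv_events M N X \<subseteq> sets F" "space F = space M"
  shows "X \<in> F \<rightarrow>\<^sub>M N"
proof (rule measurableI)
  show "X \<omega> \<in> space N" if "\<omega> \<in> space F" for \<omega>
    using that assms measurable_space[OF assms(1)] by simp
  show "X -` A \<inter> space F \<in> sets F" if "A \<in> sets N" for A
    using that assms(2,3) by (auto simp: rv_events_def)
qed

lemma subalgebra_natural_filtration:
  assumes "x0 \<in> borel_measurable M" "x1 \<in> borel_measurable M"
    and "\<And>i. 1 \<le> i \<Longrightarrow> \<xi> i \<in> M \<rightarrow>\<^sub>M S" "\<And>i. 1 \<le> i \<Longrightarrow> \<zeta> i \<in> borel_measurable M"
  shows "subalgebra M (natural_filtration M S x0 x1 \<xi> \<zeta> t)"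
  unfolding subalgebra_def sets_natural_filtration
proof (intro conjI sets.sigma_sets_subset Un_least UN_least)
qed (use assms in \<open>auto dest: rv_events_subset_sets[THEN subsetD, rotated]\<close>)

lemma natural_filtration_mono:
  "s \<le> t \<Longrightarrow> subalgebra (natural_filtration M S x0 x1 \<xi> \<zeta> t) (natural_filtration M S x0 x1 \<xi> \<zeta> s)"
  unfolding subalgebra_def sets_natural_filtration
  by (intro conjI sigma_sets_mono' Un_mono UN_mono) auto

text \<open>The strict bound \<open>i < t\<close> is essential: the sample and noise of time
  \<open>t\<close> become available only at \<open>t + 1\<close>, together with the iterate built
  from them.\<close>

lemma measurable_natural_filtration:
  fixes M S x0 x1 \<xi> \<zeta>
  defines "F \<equiv> natural_filtration M S x0 x1 \<xi> \<zeta>"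
  shows "x0 \<in> borel_measurable M \<Longrightarrow> x0 \<in> borel_measurable (F t)"
    and "x1 \<in> borel_measurable M \<Longrightarrow> x1 \<in> borel_measurable (F t)"
    and "1 \<le> i \<Longrightarrow> i < t \<Longrightarrow> \<xi> i \<in> M \<rightarrow>\<^sub>M S \<Longrightarrow> \<xi> i \<in> F t \<rightarrow>\<^sub>M S"
    and "1 \<le> i \<Longrightarrow> i < t \<Longrightarrow> \<zeta> i \<in> borel_measurable M \<Longrightarrow> \<zeta> i \<in> borel_measurable (F t)"
  unfolding F_def
  by (rule measurable_if_rv_events_subset;
      force simp: sets_natural_filtration intro!: sigma_sets.Basic)+

lemma borel_measurable_clip [measurable]: "clip q \<in> borel_measurable (borel :: 'a::euclidean_space measure)"
  unfolding clip_def[abs_def] by measurable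

theorem theorem2:
  fixes f :: "'a::euclidean_space \<Rightarrow> real"
    and grad :: "'a \<Rightarrow> 'a"
    and fstar L \<sigma>\<^sub>g \<sigma>\<^sub>C\<^sub>N q \<beta> \<theta> :: real
    and \<alpha> :: "nat \<Rightarrow> real"
    and M :: "'o measure" and S :: "'s measure"
    and G :: "'a \<Rightarrow> 's \<Rightarrow> 'a"
    and \<xi> :: "nat \<Rightarrow> 'o \<Rightarrow> 's"
    and \<zeta> x g v z :: "nat \<Rightarrow> 'o \<Rightarrow> 'a"
    and F :: "nat \<Rightarrow> 'o measure"
  assumes f_lower: "\<And>y. fstar \<le> f y"
    and f_min: "\<exists>y. f y = fstar"
    and f_grad: "\<And>y. GDERIV f y :> grad y"
    and grad_lipschitz: "L-lipschitz_on UNIV grad"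
    and prob: "prob_space M"
    and G_meas: "(\<lambda>(y, s). G y s) \<in> borel \<Otimes>\<^sub>M S \<rightarrow>\<^sub>M borel"
    and \<xi>_meas: "\<And>t. t \<ge> 1 \<Longrightarrow> \<xi> t \<in> M \<rightarrow>\<^sub>M S"
    and \<zeta>_meas: "\<And>t. t \<ge> 1 \<Longrightarrow> \<zeta> t \<in> M \<rightarrow>\<^sub>M borel"
    and x0_meas: "x 0 \<in> M \<rightarrow>\<^sub>M borel"
    and x1_meas: "x 1 \<in> M \<rightarrow>\<^sub>M borel"
    and F_eq: "\<And>t. F t = natural_filtration M S (x 0) (x 1) \<xi> \<zeta> t"
    and unbiased: "\<And>t. t \<ge> 1 \<Longrightarrow>
          AE \<omega> in M. vec_cond_exp M (F t) (\<lambda>\<omega>. G (x t \<omega>) (\<xi> t \<omega>)) \<omega> = grad (x t \<omega>)"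
    and noise_bound: "\<And>t y. t \<ge> 1 \<Longrightarrow> AE \<omega> in M. norm (G y (\<xi> t \<omega>) - grad y) \<le> \<sigma>\<^sub>g"
    and noise_bound_iterates: "\<And>t. t \<ge> 1 \<Longrightarrow>
          AE \<omega> in M. norm (G (x t \<omega>) (\<xi> t \<omega>) - grad (x t \<omega>)) \<le> \<sigma>\<^sub>g"
    and \<sigma>\<^sub>g_nonneg: "\<sigma>\<^sub>g \<ge> 0"
    and \<sigma>\<^sub>C\<^sub>N_nonneg: "\<sigma>\<^sub>C\<^sub>N \<ge> 0"
    and \<zeta>_gauss: "\<And>t. t \<ge> 1 \<Longrightarrow> distr M borel (\<zeta> t) = isotropic_gaussian \<sigma>\<^sub>C\<^sub>N"
    and \<zeta>_indep: "\<And>t. t \<ge> 1 \<Longrightarrow>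
          prob_space.indep_set M
            (sets (sigma (space M) (sets (F t) \<union> rv_events M S (\<xi> t))))
            (rv_events M borel (\<zeta> t))"
    and q: "q > \<sigma>\<^sub>g" "q > 0"
    and \<beta>: "0 \<le> \<beta>" "\<beta> < 1"
    and \<theta>: "0 < \<theta>" "\<theta> < 1/2"
    and \<alpha>_pos: "\<And>t. t \<ge> 1 \<Longrightarrow> \<alpha> t > 0"
    and \<alpha>_mono: "antimono_on {1..} \<alpha>"
    and \<alpha>_Theta: "\<alpha> \<in> \<Theta>(\<lambda>t. real t powr (-(1 - \<theta>)))"
    and g_eq: "\<And>t \<omega>. t \<ge> 1 \<Longrightarrow> \<omega> \<in> space M \<Longrightarrow>
          g t \<omega> = clip q (G (x t \<omega>) (\<xi> t \<omega>)) + q *\<^sub>R \<zeta> t \<omega>"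
    and x_step: "\<And>t \<omega>. t \<ge> 1 \<Longrightarrow> \<omega> \<in> space M \<Longrightarrow>
          x (t + 1) \<omega> = x t \<omega> - \<alpha> t *\<^sub>R g t \<omega> + \<beta> *\<^sub>R (x t \<omega> - x (t - 1) \<omega>)"
    and v_eq: "\<And>t \<omega>. t \<ge> 1 \<Longrightarrow> \<omega> \<in> space M \<Longrightarrow> v t \<omega> = x t \<omega> - x (t - 1) \<omega>"
    and z_eq: "\<And>t \<omega>. t \<ge> 1 \<Longrightarrow> \<omega> \<in> space M \<Longrightarrow>
          z t \<omega> = x t \<omega> + (\<beta> / (1 - \<beta>)) *\<^sub>R v t \<omega>"
  shows "(AE \<omega> in M. summable (\<lambda>t. \<alpha> (Suc t) * Psi q (norm (grad (x (Suc t) \<omega>)))))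
    \<and> (AE \<omega> in M. summable (\<lambda>t. (norm (v (Suc t) \<omega>))\<^sup>2))
    \<and> (AE \<omega> in M. (\<lambda>t. norm (v t \<omega>)) \<longlonglongrightarrow> 0)
    \<and> (AE \<omega> in M. (\<lambda>t. norm (z t \<omega> - x t \<omega>)) \<longlonglongrightarrow> 0)
    \<and> (AE \<omega> in M. (\<lambda>t. MIN i\<in>{1..t}. Psi q (norm (grad (x i \<omega>)))) \<in> o(\<lambda>t. real t powr (-\<theta>)))
    \<and> (AE \<omega> in M. (\<lambda>t. MIN i\<in>{1..t}. norm (grad (x i \<omega>))) \<in> o(\<lambda>t. real t powr (-\<theta>/2)))
    \<and> (\<forall>\<mu>>0. (\<forall>y w. f w \<ge> f y + grad y \<bullet> (w - y) + \<mu> / 2 * (norm (w - y))\<^sup>2) \<longrightarrow>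
         (AE \<omega> in M. (\<lambda>t. MIN i\<in>{1..t}. f (x i \<omega>) - fstar) \<in> o(\<lambda>t. real t powr (-\<theta>))))"
proof -

  \<comment> \<open>Adaptedness of the iterates\<close>
  interpret prob_space M by (rule prob)
  have F_eq': "F = natural_filtration M S (x 0) (x 1) \<xi> \<zeta>" using F_eq by auto
  have F_sub: "subalgebra M (F t)" for t
    unfolding F_eq' using x0_meas x1_meas \<xi>_meas \<zeta>_meas by (rule subalgebra_natural_filtration)
  have F_mono: "subalgebra (F (Suc t)) (F t)" for t
    unfolding F_eq' by (rule natural_filtration_mono) simp
  have space_F [simp]: "space (F t) = space M" for t by (simp add: F_eq')
  have F_x01: "x 0 \<in> borel_measurable (F t)" "x 1 \<in> borel_measurable (F t)" for t
    unfolding F_eq' by (intro measurable_natural_filtration x0_meas x1_meas)+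
  have F_\<xi>: "\<xi> (Suc n) \<in> F (Suc (Suc n)) \<rightarrow>\<^sub>M S"
    and F_\<zeta>: "\<zeta> (Suc n) \<in> borel_measurable (F (Suc (Suc n)))" for n
    unfolding F_eq' by (intro measurable_natural_filtration \<xi>_meas \<zeta>_meas; simp)+
  have grad_meas [measurable]: "grad \<in> borel_measurable borel"
    using grad_lipschitz by (intro borel_measurable_continuous_onI lipschitz_on_continuous_on)
  \<comment> \<open>The source \<open>R\<close> is left open to cover both the filtration and
    \<open>M\<close> itself.\<close>
  have G_comp: "(\<lambda>\<omega>. G (X \<omega>) (Z \<omega>)) \<in> borel_measurable R"
    if "X \<in> borel_measurable R" "Z \<in> R \<rightarrow>\<^sub>M S" for X Z and R :: "'o measure"
    using measurable_compose[OF measurable_Pair[OF that] G_meas] by simp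
  have x_F: "x n \<in> borel_measurable (F (Suc n)) \<and> x (Suc n) \<in> borel_measurable (F (Suc n))" for n
  proof (induction n)
    case 0 then show ?case using F_x01 by simp
  next
    case (Suc n)
    have [measurable]: "x n \<in> borel_measurable (F (Suc (Suc n)))" "x (Suc n) \<in> borel_measurable (F (Suc (Suc n)))"
      using Suc measurable_from_subalg[OF F_mono] by blast+
    note F_\<xi>[measurable] F_\<zeta>[measurable]
    have [measurable]: "(\<lambda>\<omega>. G (x (Suc n) \<omega>) (\<xi> (Suc n) \<omega>)) \<in> borel_measurable (F (Suc (Suc n)))"
      by (rule G_comp) measurable
    have "(\<lambda>\<omega>. x (Suc n) \<omega> - \<alpha> (Suc n) *\<^sub>R (clip q (G (x (Suc n) \<omega>) (\<xi> (Suc n) \<omega>)) + q *\<^sub>R \<zeta> (Suc n) \<omega>)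
        + \<beta> *\<^sub>R (x (Suc n) \<omega> - x n \<omega>)) \<in> borel_measurable (F (Suc (Suc n)))"
      by measurable
    moreover have "x (Suc (Suc n)) \<omega> = x (Suc n) \<omega> - \<alpha> (Suc n) *\<^sub>R (clip q (G (x (Suc n) \<omega>) (\<xi> (Suc n) \<omega>))
        + q *\<^sub>R \<zeta> (Suc n) \<omega>) + \<beta> *\<^sub>R (x (Suc n) \<omega> - x n \<omega>)" if "\<omega> \<in> space (F (Suc (Suc n)))" for \<omega>
      using x_step[of "Suc n" \<omega>] g_eq[of "Suc n" \<omega>] that by simp
    ultimately have "x (Suc (Suc n)) \<in> borel_measurable (F (Suc (Suc n)))"
      by (subst measurable_cong) auto
    then show ?case by simp
  qed
  have x_F1: "x t \<in> borel_measurable (F t)" if "1 \<le> t" for t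
    using x_F[of "t - 1"] that by simp
  have x_M [measurable]: "x t \<in> borel_measurable M" for t
    using x_F[of t] measurable_from_subalg[OF F_sub] by blast
  have Y_M: "(\<lambda>\<omega>. G (x t \<omega>) (\<xi> t \<omega>)) \<in> borel_measurable M" if "1 \<le> t" for t
    using that by (intro G_comp \<xi>_meas) auto

  \<comment> \<open>Second moments of noise and clipped gradients\<close>
  define m2 where "m2 = (\<integral>y. (norm y)\<^sup>2 \<partial>(isotropic_gaussian \<sigma>\<^sub>C\<^sub>N :: 'a measure))"
  have \<zeta>_sq: "square_integrable M (\<zeta> t)" and \<zeta>_m2: "(\<integral>\<omega>. (norm (\<zeta> t \<omega>))\<^sup>2 \<partial>M) = m2"
    and \<zeta>_mean: "(\<integral>\<omega>. \<zeta> t \<omega> \<bullet> b \<partial>M) = 0" if t: "1 \<le> t" for t b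
  proof -
    note [measurable] = \<zeta>_meas[OF t]
    show "square_integrable M (\<zeta> t)"
      using isotropic_gaussian_moments(1)[of \<sigma>\<^sub>C\<^sub>N, where 'a = 'a] \<zeta>_gauss[OF t, symmetric]
      by (simp add: square_integrable_def integrable_distr_eq)
    show "(\<integral>\<omega>. (norm (\<zeta> t \<omega>))\<^sup>2 \<partial>M) = m2"
      unfolding m2_def \<zeta>_gauss[OF t, symmetric] by (subst integral_distr) auto
    show "(\<integral>\<omega>. \<zeta> t \<omega> \<bullet> b \<partial>M) = 0"
      using isotropic_gaussian_moments(2)[of \<sigma>\<^sub>C\<^sub>N b] unfolding \<zeta>_gauss[OF t, symmetric]
      by (subst (asm) integral_distr) auto
  qed
  have clip_sq: "square_integrable M (\<lambda>\<omega>. clip q (G (x t \<omega>) (\<xi> t \<omega>)))" if "1 \<le> t" for t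
    using Y_M[OF that] norm_clip_le[OF q(2)] by (intro square_integrable_bounded[where C = q]) auto
  have g_sq: "square_integrable M (g t)" if t: "1 \<le> t" for t
    using square_integrable_add[OF clip_sq[OF t] square_integrable_scaleR[OF \<zeta>_sq[OF t], of q]]
      square_integrable_cong[of M "g t", OF g_eq[OF t]] by simp
  have g_m2: "(\<integral>\<omega>. (norm (g t \<omega>))\<^sup>2 \<partial>M) \<le> 2 * q\<^sup>2 + 2 * q\<^sup>2 * m2" if t: "1 \<le> t" for t
  proof -
    have "(\<integral>\<omega>. (norm (g t \<omega>))\<^sup>2 \<partial>M) \<le> (\<integral>\<omega>. 2 * q\<^sup>2 + 2 * q\<^sup>2 * (norm (\<zeta> t \<omega>))\<^sup>2 \<partial>M)"
    proof (rule integral_mono)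
      fix \<omega> assume \<omega>: "\<omega> \<in> space M"
      define y where "y = clip q (G (x t \<omega>) (\<xi> t \<omega>))"
      have "(norm (g t \<omega>))\<^sup>2 \<le> 2 * (norm y)\<^sup>2 + 2 * (norm (q *\<^sub>R \<zeta> t \<omega>))\<^sup>2"
        unfolding g_eq[OF t \<omega>] y_def by (rule norm_add_sq_le)
      moreover have "(norm y)\<^sup>2 \<le> q\<^sup>2"
        unfolding y_def by (intro power_mono norm_clip_le q) auto
      ultimately show "(norm (g t \<omega>))\<^sup>2 \<le> 2 * q\<^sup>2 + 2 * q\<^sup>2 * (norm (\<zeta> t \<omega>))\<^sup>2"
        by (simp add: power_mult_distrib)
    qed (use square_integrable_norm_sq[OF g_sq[OF t]] square_integrable_norm_sq[OF \<zeta>_sq[OF t]] in auto)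
    also have "\<dots> = 2 * q\<^sup>2 + 2 * q\<^sup>2 * m2"
      using square_integrable_norm_sq[OF \<zeta>_sq[OF t]] \<zeta>_m2[OF t] by (simp add: prob_space)
    finally show ?thesis .
  qed

  text \<open>Nothing is assumed about the moments of the initial points. Weighting the probability by
    this positive \<open>F 1\<close>-measurable density makes all iterates square integrable, keeps the null
    sets, and leaves the martingale differences centred.\<close>
  define w where "w \<omega> = 1 / (1 + (norm (x 0 \<omega>))\<^sup>2 + (norm (x 1 \<omega>))\<^sup>2)" for \<omega>
  have den: "0 < 1 + (norm (x 0 \<omega>))\<^sup>2 + (norm (x 1 \<omega>))\<^sup>2" for \<omega>
    by (simp add: add_pos_nonneg)
  have w_pos: "0 < w \<omega>" and w_le: "w \<omega> \<le> 1" for \<omega>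
    using den[of \<omega>] by (auto simp: w_def divide_le_eq)
  have w_x: "w \<omega> * (norm (x 0 \<omega>))\<^sup>2 \<le> 1" "w \<omega> * (norm (x 1 \<omega>))\<^sup>2 \<le> 1" for \<omega>
    using den[of \<omega>] by (auto simp: w_def divide_le_eq)
  have w_nn: "0 \<le> w \<omega>" for \<omega> using w_pos[of \<omega>] by simp
  have w_F: "w \<in> borel_measurable (F t)" for t
    unfolding w_def[abs_def] using F_x01[of t] by measurable
  have w_M [measurable]: "w \<in> borel_measurable M"
    using measurable_from_subalg[OF F_sub w_F] .
  define N where "N = density M (\<lambda>\<omega>. ennreal (w \<omega>))"
  have N_AE: "(AE \<omega> in N. P \<omega>) \<longleftrightarrow> (AE \<omega> in M. P \<omega>)" for P
    unfolding N_def by (subst AE_density) (auto simp: w_pos)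
  have N_int: "integrable N u \<longleftrightarrow> integrable M (\<lambda>\<omega>. w \<omega> * u \<omega>)"
    and N_integral: "(\<integral>\<omega>. u \<omega> \<partial>N) = (\<integral>\<omega>. w \<omega> * u \<omega> \<partial>M)"
    if "u \<in> borel_measurable M" for u :: "'o \<Rightarrow> real"
    unfolding N_def using that w_nn by (auto simp: integrable_density integral_density)
  have N_sq: "square_integrable N X \<longleftrightarrow>
      X \<in> borel_measurable M \<and> integrable M (\<lambda>\<omega>. w \<omega> * (norm (X \<omega>))\<^sup>2)" for X :: "'o \<Rightarrow> 'a"
    unfolding square_integrable_def using N_int[of "\<lambda>\<omega>. (norm (X \<omega>))\<^sup>2"] by (auto simp: N_def)
  have "emeasure N (space N) = (\<integral>\<^sup>+ \<omega>. ennreal (w \<omega>) \<partial>M)"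
    unfolding N_def by (subst emeasure_density) (auto intro!: nn_integral_cong)
  also have "\<dots> \<le> (\<integral>\<^sup>+ \<omega>. 1 \<partial>M)" using w_le by (intro nn_integral_mono) simp
  also have "\<dots> = 1" by (simp add: emeasure_space_1)
  finally have "emeasure N (space N) \<noteq> \<infinity>" by (auto simp: top_unique)
  then have fin_N: "finite_measure N" by (rule finite_measureI)
  interpret N: finite_measure N by (rule fin_N)

  \<comment> \<open>The drift inequality under the weighted measure\<close>
  define c where "c = (q - \<sigma>\<^sub>g) / q"
  define h where "h y = Psi q (norm (grad y))" for y
  have c: "0 < c" using q by (simp add: c_def)
  have h_nn: "0 \<le> h y" for y unfolding h_def by (intro Psi_nonneg q) simp
  have h_le: "h y \<le> (norm (grad y))\<^sup>2" for y by (simp add: h_def Psi_def)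
  have h_meas [measurable]: "h \<in> borel_measurable borel"
    unfolding h_def[abs_def] Psi_def by measurable

  have drift: "c * (\<integral>\<omega>. h (x t \<omega>) \<partial>N) \<le> (\<integral>\<omega>. grad (x t \<omega>) \<bullet> g t \<omega> \<partial>N)"
    if t: "1 \<le> t" and x_sq: "square_integrable N (x t)" for t
  proof -
    \<comment> \<open>Unbiasedness and independence are known under \<open>M\<close>, not under
      \<open>N\<close>. Moving the weight into this \<open>F t\<close>-measurable vector turns
      integrals over \<open>N\<close> into integrals over \<open>M\<close>, where both
      apply.\<close>
    define \<phi> where "\<phi> \<omega> = w \<omega> *\<^sub>R grad (x t \<omega>)" for \<omega>
    define m where "m \<omega> = grad (x t \<omega>)" for \<omega>
    define Y where "Y \<omega> = G (x t \<omega>) (\<xi> t \<omega>)" for \<omega>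
    interpret Ft: finite_measure_subalgebra M "F t"
      by unfold_locales (rule F_sub)
    have m_F: "m \<in> borel_measurable (F t)"
      unfolding m_def[abs_def] using x_F1[OF t] by measurable
    have \<phi>_F: "\<phi> \<in> borel_measurable (F t)"
      unfolding \<phi>_def[abs_def] using x_F1[OF t] w_F[of t] by measurable
    have m_M [measurable]: "m \<in> borel_measurable M" and \<phi>_M [measurable]: "\<phi> \<in> borel_measurable M"
      using measurable_from_subalg[OF F_sub] m_F \<phi>_F by blast+
    have Y_M' [measurable]: "Y \<in> borel_measurable M" unfolding Y_def[abs_def] by (rule Y_M[OF t])
    have wm: "integrable M (\<lambda>\<omega>. w \<omega> * (norm (m \<omega>))\<^sup>2)"
      using N.square_integrable_lipschitz[OF x_sq grad_lipschitz] unfolding N_sq m_def by simp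
    have \<phi>_sq: "square_integrable M \<phi>"
      unfolding square_integrable_def
    proof (intro conjI \<phi>_M Bochner_Integration.integrable_bound[OF wm] AE_I2)
      fix \<omega>
      \<comment> \<open>Since the weight lies between 0 and 1, its square is at most itself, so
        \<phi> is square integrable under \<open>M\<close> as soon as the gradient is under
        \<open>N\<close>.\<close>
      have "(w \<omega>)\<^sup>2 * (norm (m \<omega>))\<^sup>2 \<le> w \<omega> * (norm (m \<omega>))\<^sup>2"
        using w_nn[of \<omega>] w_le[of \<omega>] by (intro mult_right_mono) (auto simp: power2_eq_square mult_left_le)
      then show "norm ((norm (\<phi> \<omega>))\<^sup>2) \<le> norm (w \<omega> * (norm (m \<omega>))\<^sup>2)"
        using w_nn[of \<omega>] by (simp add: \<phi>_def m_def power_mult_distrib)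
    qed measurable
    have bd: "AE \<omega> in M. norm (Y \<omega> - m \<omega>) \<le> \<sigma>\<^sub>g"
      using noise_bound_iterates[OF t] by (simp add: Y_def m_def)
    have ce: "AE \<omega> in M. vec_cond_exp M (F t) Y \<omega> = m \<omega>"
      using unbiased[OF t] by (simp add: Y_def[abs_def] m_def)
    note noise = Ft.integral_inner_vec_cond_exp_diff[OF m_F Y_M' ce bd \<phi>_F \<phi>_sq]
    have "sets (F t) \<subseteq> sets (sigma (space M) (sets (F t) \<union> rv_events M S (\<xi> t)))"
    proof -
      have "sets (F t) \<union> rv_events M S (\<xi> t) \<subseteq> Pow (space M)"
        using sets.space_closed[of "F t"] by (auto simp: rv_events_def)
      then show ?thesis by (auto simp: sets_measure_of)
    qed
    then have "indep_set (sets (F t)) (rv_events M borel (\<zeta> t))"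
      using \<zeta>_indep[OF t] unfolding indep_set_def
      by (elim indep_sets_mono_sets) (auto split: bool.split)
    then have \<zeta>_zero: "(\<integral>\<omega>. \<phi> \<omega> \<bullet> \<zeta> t \<omega> \<partial>M) = 0"
      by (rule integral_inner_indep[OF _ F_sub \<phi>_F \<phi>_sq \<zeta>_sq[OF t] \<zeta>_mean[OF t]])
    have \<zeta>_int: "integrable M (\<lambda>\<omega>. \<phi> \<omega> \<bullet> \<zeta> t \<omega>)"
      by (rule square_integrable_inner[OF \<phi>_sq \<zeta>_sq[OF t]])
    have clip_int: "integrable M (\<lambda>\<omega>. \<phi> \<omega> \<bullet> clip q (Y \<omega>))"
      unfolding Y_def by (rule square_integrable_inner[OF \<phi>_sq clip_sq[OF t]])
    have h_int: "integrable M (\<lambda>\<omega>. w \<omega> * h (x t \<omega>))"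
    proof (rule Bochner_Integration.integrable_bound[OF wm])
      show "AE \<omega> in M. norm (w \<omega> * h (x t \<omega>)) \<le> norm (w \<omega> * (norm (m \<omega>))\<^sup>2)"
        using w_nn h_nn h_le by (auto simp: abs_mult m_def intro!: mult_left_mono)
    qed measurable
    \<comment> \<open>The noise term has integral zero; it is inserted so that the pathwise clipping
      bound applies under the integral.\<close>
    have "c * (\<integral>\<omega>. h (x t \<omega>) \<partial>N) = (\<integral>\<omega>. \<phi> \<omega> \<bullet> (Y \<omega> - m \<omega>) + c * (w \<omega> * h (x t \<omega>)) \<partial>M)"
      using noise h_int N_integral[of "\<lambda>\<omega>. h (x t \<omega>)"] by simp
    also have "\<dots> \<le> (\<integral>\<omega>. \<phi> \<omega> \<bullet> clip q (Y \<omega>) \<partial>M)"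
    proof (rule integral_mono_AE)
      show "AE \<omega> in M. \<phi> \<omega> \<bullet> (Y \<omega> - m \<omega>) + c * (w \<omega> * h (x t \<omega>)) \<le> \<phi> \<omega> \<bullet> clip q (Y \<omega>)"
        using bd
      proof eventually_elim
        case (elim \<omega>)
        have "m \<omega> \<bullet> (Y \<omega> - m \<omega>) + c * h (x t \<omega>) \<le> m \<omega> \<bullet> clip q (Y \<omega>)"
          using inner_clip_ge[OF \<sigma>\<^sub>g_nonneg q(1) elim] by (simp add: c_def h_def m_def)
        then have "w \<omega> * (m \<omega> \<bullet> (Y \<omega> - m \<omega>) + c * h (x t \<omega>)) \<le> w \<omega> * (m \<omega> \<bullet> clip q (Y \<omega>))"
          by (rule mult_left_mono[OF _ w_nn])
        then show ?case by (simp add: \<phi>_def m_def distrib_left mult.left_commute)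
      qed
    qed (use noise h_int clip_int in auto)
    also have "\<dots> = (\<integral>\<omega>. \<phi> \<omega> \<bullet> clip q (Y \<omega>) + q * (\<phi> \<omega> \<bullet> \<zeta> t \<omega>) \<partial>M)"
      using clip_int \<zeta>_int \<zeta>_zero by simp
    also have "\<dots> = (\<integral>\<omega>. w \<omega> * (grad (x t \<omega>) \<bullet> g t \<omega>) \<partial>M)"
      by (intro Bochner_Integration.integral_cong refl)
        (simp add: g_eq[OF t] \<phi>_def Y_def inner_add_right distrib_left mult.left_commute)
    also have "\<dots> = (\<integral>\<omega>. grad (x t \<omega>) \<bullet> g t \<omega> \<partial>N)"
      using square_integrable_measurable[OF g_sq[OF t]] by (intro N_integral[symmetric]) measurable
    finally show ?thesis .
  qed

  \<comment> \<open>Summable squared steps and almost sure sums\<close>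
  have \<alpha>_sq: "summable (\<lambda>n. (\<alpha> (Suc n))\<^sup>2)"
  proof -
    have "\<alpha> \<in> O(\<lambda>t. real t powr (-(1 - \<theta>)))" using \<alpha>_Theta by (rule bigthetaD1)
    then have "(\<lambda>t. (\<alpha> t)\<^sup>2) \<in> O(\<lambda>t. (real t powr (-(1 - \<theta>)))\<^sup>2)" by (rule landau_o.big_power)
    moreover have "(\<lambda>t. (real t powr (-(1 - \<theta>)))\<^sup>2) = (\<lambda>t. real t powr (-2 * (1 - \<theta>)))"
      by (simp add: power2_eq_square flip: powr_add)
    \<comment> \<open>The exponent is below -1 exactly when \<theta> < 1/2.\<close>
    moreover have "summable (\<lambda>t. norm (real t powr (-2 * (1 - \<theta>))))"
      using \<theta> by (simp add: summable_real_powr_iff)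
    ultimately have "summable (\<lambda>t. (\<alpha> t)\<^sup>2)" using summable_comparison_test_bigo by metis
    then show ?thesis by (subst summable_Suc_iff)
  qed

  have sums: "AE \<omega> in N. summable (\<lambda>n. \<alpha> (Suc n) * h (x (Suc n) \<omega>))"
    "AE \<omega> in N. summable (\<lambda>n. (norm (x (Suc n) \<omega> - x n \<omega>))\<^sup>2)"
  proof -
    have init: "square_integrable N (x 0)" "square_integrable N (x 1)"
      unfolding N_sq using w_x w_nn by (auto intro!: integrable_const_bound[where B = 1])
    have gN: "square_integrable N (g t)" "(\<integral>\<omega>. (norm (g t \<omega>))\<^sup>2 \<partial>N) \<le> 2 * q\<^sup>2 + 2 * q\<^sup>2 * m2"
      if t: "1 \<le> t" for t
      using integral_density_le[OF w_M w_nn w_le square_integrable_norm_sq[OF g_sq[OF t]]]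
        square_integrable_measurable[OF g_sq[OF t]] g_m2[OF t]
      by (auto simp: square_integrable_def N_def)
    have step: "x (t + 1) \<omega> = x t \<omega> - \<alpha> t *\<^sub>R g t \<omega> + \<beta> *\<^sub>R (x t \<omega> - x (t - 1) \<omega>)"
      if "1 \<le> t" "\<omega> \<in> space N" for t \<omega> using x_step that by (simp add: N_def)
    note * = N.heavy_ball_summable[OF f_lower f_grad grad_lipschitz h_meas h_nn h_le \<beta> c
        less_imp_le[OF \<alpha>_pos] \<alpha>_sq init gN drift step]
    show "AE \<omega> in N. summable (\<lambda>n. \<alpha> (Suc n) * h (x (Suc n) \<omega>))"
      "AE \<omega> in N. summable (\<lambda>n. (norm (x (Suc n) \<omega> - x n \<omega>))\<^sup>2)"
      by (rule *; assumption)+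
  qed

  \<comment> \<open>Almost sure conclusions under the original probability\<close>
  have S1: "AE \<omega> in M. summable (\<lambda>t. \<alpha> (Suc t) * Psi q (norm (grad (x (Suc t) \<omega>))))"
    using sums(1) unfolding N_AE h_def .
  have S2: "AE \<omega> in M. summable (\<lambda>t. (norm (v (Suc t) \<omega>))\<^sup>2)"
    using sums(2)[unfolded N_AE] AE_space by eventually_elim (simp add: v_eq)
  have S3: "AE \<omega> in M. (\<lambda>t. norm (v t \<omega>)) \<longlonglongrightarrow> 0"
    using S2
  proof eventually_elim
    case (elim \<omega>)
    then have "(\<lambda>t. sqrt ((norm (v (Suc t) \<omega>))\<^sup>2)) \<longlonglongrightarrow> sqrt 0"
      by (intro tendsto_real_sqrt summable_LIMSEQ_zero)
    then have "(\<lambda>t. norm (v (Suc t) \<omega>)) \<longlonglongrightarrow> 0" by simp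
    then show ?case by (rule LIMSEQ_imp_Suc)
  qed
  have S4: "AE \<omega> in M. (\<lambda>t. norm (z t \<omega> - x t \<omega>)) \<longlonglongrightarrow> 0"
    using S3 AE_space
  proof eventually_elim
    case (elim \<omega>)
    have "(\<lambda>t. \<bar>\<beta> / (1 - \<beta>)\<bar> * norm (v t \<omega>)) \<longlonglongrightarrow> 0"
      using elim(1) by (rule tendsto_mult_right_zero)
    \<comment> \<open>The equality is only eventual because \<open>z\<close> and \<open>v\<close>
      are specified from time 1 on.\<close>
    moreover have "\<forall>\<^sub>F t in sequentially. \<bar>\<beta> / (1 - \<beta>)\<bar> * norm (v t \<omega>) = norm (z t \<omega> - x t \<omega>)"
      using eventually_ge_at_top[of 1] by eventually_elim (simp add: z_eq elim(2))
    ultimately show ?case by (rule Lim_transform_eventually)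
  qed
  have S5: "AE \<omega> in M. (\<lambda>t. MIN i\<in>{1..t}. Psi q (norm (grad (x i \<omega>)))) \<in> o(\<lambda>t. real t powr (-\<theta>))"
    using S1
  proof eventually_elim
    case (elim \<omega>)
    have "\<alpha> \<in> \<Omega>(\<lambda>t. real t powr (-(1 - \<theta>)))" using \<alpha>_Theta by (rule bigthetaD2)
    from running_min_smallo[OF \<alpha>_pos \<alpha>_mono this, of "\<lambda>i. Psi q (norm (grad (x i \<omega>)))"] elim
    show ?case by (simp add: Psi_nonneg q)
  qed
  \<comment> \<open>The squared norm is kept because it dominates the function gap, which therefore
    decays with exponent \<theta> rather than \<open>\<theta>/2\<close>.\<close>
  have S6: "AE \<omega> in M. (\<lambda>t. (MIN i\<in>{1..t}. norm (grad (x i \<omega>)))\<^sup>2) \<in> o(\<lambda>t. real t powr (-\<theta>))"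
    using S5 by eventually_elim (rule running_min_norm_smallo(1)[OF q(2) norm_ge_zero \<theta>(1)])
  have S7: "AE \<omega> in M. (\<lambda>t. MIN i\<in>{1..t}. norm (grad (x i \<omega>))) \<in> o(\<lambda>t. real t powr (-\<theta>/2))"
    using S5 by eventually_elim (rule running_min_norm_smallo(2)[OF q(2) norm_ge_zero \<theta>(1)])
  have S8: "AE \<omega> in M. (\<lambda>t. MIN i\<in>{1..t}. f (x i \<omega>) - fstar) \<in> o(\<lambda>t. real t powr (-\<theta>))"
    if \<mu>: "\<mu> > 0" and sc: "\<And>y u. f u \<ge> f y + grad y \<bullet> (u - y) + \<mu> / 2 * (norm (u - y))\<^sup>2" for \<mu>
    using S6
  proof eventually_elim
    case (elim \<omega>)
    define P where "P t = (MIN i\<in>{1..t}. norm (grad (x i \<omega>)))" for t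
    have "\<forall>\<^sub>F t in at_top. norm (MIN i\<in>{1..t}. f (x i \<omega>) - fstar) \<le> 1 / (2 * \<mu>) * norm ((P t)\<^sup>2)"
      using eventually_ge_at_top[of "1::nat"]
    proof eventually_elim
      case (elim t)
      have "P t \<in> (\<lambda>i. norm (grad (x i \<omega>))) ` {1..t}" unfolding P_def using elim by (intro Min_in) auto
      \<comment> \<open>The gap is evaluated at the index where the gradient norm is smallest; the
        running minimum of the gaps can only be lower.\<close>
      then obtain i where i: "i \<in> {1..t}" "P t = norm (grad (x i \<omega>))" by auto
      obtain y where y: "f y = fstar" using f_min by auto
      have "(MIN i\<in>{1..t}. f (x i \<omega>) - fstar) \<le> f (x i \<omega>) - fstar"
        using i by (intro Min_le) auto
      also have "\<dots> \<le> (P t)\<^sup>2 / (2 * \<mu>)"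
        using strongly_convex_gap_le[where f = f and g = grad, OF \<mu> sc, of "x i \<omega>" y] y i(2) by simp
      finally have "(MIN i\<in>{1..t}. f (x i \<omega>) - fstar) \<le> (P t)\<^sup>2 / (2 * \<mu>)" .
      moreover have "0 \<le> (MIN i\<in>{1..t}. f (x i \<omega>) - fstar)"
        using elim f_lower by (subst Min_ge_iff) auto
      ultimately show ?case by simp
    qed
    then have "(\<lambda>t. MIN i\<in>{1..t}. f (x i \<omega>) - fstar) \<in> O(\<lambda>t. (P t)\<^sup>2)"
      using \<mu> by (intro landau_o.bigI[of "1 / (2 * \<mu>)"]) auto
    then show ?case using elim unfolding P_def by (rule landau_o.big_small_trans)
  qed
  show ?thesis using S1 S2 S3 S4 S5 S7 S8 by blast
qed

end
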